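(* Let $q\in\,]0,1[$ and let $\mu$ be a positive measure on the unit circle of the form $d\mu(\theta)=w(e^{i\theta})\,d\theta$ (with $w$ not identically zero), where $w$ is holomorphic in $\mathbf C^*$ and satisfies $w(qz)=\frac{V(z)}{W(z)}w(z)$ for some polynomials $V,W$. Put $D=\max(\deg V,\deg W)$. Let $\phi_n,\phi_n^*,\epsilon_n,\epsilon_n^*,\alpha_n,\sigma_n$ be associated with $\mu$ as in the context, and let $n\ge 1$ be such that $\alpha_{n+1}\neq 0$. Set $$Y_n(z)=\begin{pmatrix}\phi_n(z)&\frac{\epsilon_n(z)}{w(z)}\\ \phi_n^*(z)&-\frac{\epsilon_n^*(z)}{w(z)}\end{pmatrix},\qquad B_n(z)=\begin{pmatrix}z&\alpha_{n+1}\\ z\bar\alpha_{n+1}&1\end{pmatrix}.$$ Then the expressions $\Theta_n,\Omega_n$ defined by $$2\alpha_{n+1}\sigma_nz^n\Theta_n(z)=W(z)\epsilon_n(qz)\phi_n(z)-V(z)\epsilon_n(z)\phi_n(qz),$$ $$2\alpha_{n+1}\sigma_nz^n\Omega_n(z)=W(z)\epsilon_n(qz)\phi_{n+1}(z)-V(z)\epsilon_{n+1}(z)\phi_n(qz)$$ are polynomials of degree at most $D-1$ and at most $D$ respectively, and there are polynomials $\Theta_n^*$ and $\Omega_n^*$, of degree at most $D-1$ and at most $D$ respectively, such that with $$A_n(z)=\begin{pmatrix}\Omega_n(z)-z\Theta_n(z)&-\alpha_{n+1}\Theta_n(z)\\ -z\bar\alpha_{n+1}\Theta_n^*(z)&\Omega_n^*(z)-\Theta_n^*(z)\end{pmatrix}$$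 one has $$Y_n(qz)=\frac{1}{V(z)}A_n(z)Y_n(z).$$ Moreover, if also $\alpha_{n+2}\ne0$ (so that $A_{n+1}$ is defined in the same way), the compatibility of this equation with the recursion $Y_{n+1}(z)=B_n(z)Y_n(z)$ implies $$A_{n+1}(z)B_n(z)=B_n(qz)A_n(z).$$
   Context: Orthogonal polynomials: $\phi_n(z)=z^n+\cdots$ are the monic polynomials orthogonal in $L^2(\mu)$ on the unit circle, obtained from $1,z,z^2,\dots$ by Gram–Schmidt. $\sigma_n=\int|\phi_n|^2d\mu$, $\alpha_n=\phi_n(0)$ (Verblunsky coefficients), and $\phi_n^*(z)=z^n\,\overline{\phi_n(1/\bar z)}$. They satisfy $\phi_{n+1}(z)=z\phi_n(z)+\alpha_{n+1}\phi_n^*(z)$ and $\phi_{n+1}^*(z)=\phi_n^*(z)+\bar\alpha_{n+1}z\phi_n(z)$. The Caratheodory function is $F(z)=\int\frac{e^{i\theta}+z}{e^{i\theta}-z}d\mu(\theta)$, holomorphic for $|z|\neq1$. For $n\ge1$ the associated polynomials are $$\psi_n(z)=\int\frac{e^{i\theta}+z}{e^{i\theta}-z}(\phi_n(e^{i\theta})-\phi_n(z))\,d\mu(\theta),\qquad \psi_n^*(z)=-\int\frac{e^{i\theta}+z}{e^{i\theta}-z}\big(z^n\overline{\phi_n(e^{i\theta})}-\phi_n^*(z)\big)\,d\mu(\theta),$$ and $\epsilon_n(z)=\psi_n(z)+F(z)\phi_n(z)$, $\epsilon_n^*(z)=\psi_n^*(z)-F(z)\phi_n^*(z)$ for $|z|\ne1$.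 They satisfy $\epsilon_{n+1}=z\epsilon_n-\alpha_{n+1}\epsilon_n^*$ and $\epsilon_{n+1}^*=\epsilon_n^*-\bar\alpha_{n+1}z\epsilon_n$. Since $F$ (hence $\epsilon_n,\epsilon_n^*$) consists of two analytic functions, one for $|z|<1$ and one for $|z|>1$, the identities involving $\epsilon_n,\epsilon_n^*$ at both $z$ and $qz$ are understood as identities of meromorphic functions on each of the domains $\{0<|z|<1\}$ and $\{|z|>1/q\}$ (where $z$ and $qz$ lie on the same side of the unit circle). The identities between polynomials hold for all $z$. A polynomial of degree at most $-1$ is zero. *)

theory Defs
  imports "HOL-Complex_Analysis.Complex_Analysis" "HOL-Computational_Algebra.Polynomial"
begin

text \<open>
  A measure on the unit circle is a Borel measure on \<^typ>\<open>complex\<close>; the integration variable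
  \<open>\<zeta>\<close> stands for \<open>exp (\<i> \<theta>)\<close>. The measure \<open>circle_measure w\<close> is the image under \<open>\<theta> \<mapsto> exp (\<i> \<theta>)\<close>
  of \<open>w (exp (\<i> \<theta>)) d\<theta>\<close> on \<open>[0, 2\<pi>)\<close>; there is no factor \<open>1 / (2\<pi>)\<close>. It is only
  meaningful when \<open>w\<close> is real and nonnegative on the circle.
\<close>

definition circle_measure :: "(complex \<Rightarrow> complex) \<Rightarrow> complex measure" where
  "circle_measure w =
     distr (density (restrict_space lborel {0..<2*pi}) (\<lambda>\<theta>. ennreal (Re (w (cis \<theta>))))) borel cis"

definition poly_inner :: "complex measure \<Rightarrow> complex poly \<Rightarrow> complex poly \<Rightarrow> complex" where
  "poly_inner \<mu> f g = (LINT \<zeta>|\<mu>. poly f \<zeta> * cnj (poly g \<zeta>))"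

text \<open>Gram--Schmidt applied to \<open>1, z, z\<^sup>2, \<dots>\<close> without normalization, so every member is monic.\<close>

fun opuc :: "complex measure \<Rightarrow> nat \<Rightarrow> complex poly" where
  "opuc \<mu> n = monom 1 n -
     (\<Sum>k<n. smult (poly_inner \<mu> (monom 1 n) (opuc \<mu> k) / poly_inner \<mu> (opuc \<mu> k) (opuc \<mu> k))
                   (opuc \<mu> k))"

declare opuc.simps [simp del]

definition opuc_star :: "complex measure \<Rightarrow> nat \<Rightarrow> complex poly" where
  "opuc_star \<mu> n = map_poly cnj (reflect_poly (opuc \<mu> n))"

lemma opuc_degree_monic: "degree (opuc \<mu> n) = n \<and> lead_coeff (opuc \<mu> n) = 1"
proof (induction n rule: less_induct)
  case (less n)
  define S where "S = (\<Sum>k<n. smult (poly_inner \<mu> (monom 1 n) (opuc \<mu> k) /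
      poly_inner \<mu> (opuc \<mu> k) (opuc \<mu> k)) (opuc \<mu> k))"
  have eq: "opuc \<mu> n = monom 1 n - S"
    by (subst opuc.simps) (simp add: S_def)
  have S: "coeff S i = 0" if "i \<ge> n" for i
    unfolding S_def coeff_sum
  proof (intro sum.neutral ballI)
    fix k assume "k \<in> {..<n}"
    then have "degree (opuc \<mu> k) < i" using less that by auto
    then show "coeff (smult (poly_inner \<mu> (monom 1 n) (opuc \<mu> k) /
      poly_inner \<mu> (opuc \<mu> k) (opuc \<mu> k)) (opuc \<mu> k)) i = 0"
      by (simp add: coeff_eq_0)
  qed
  have n: "coeff (opuc \<mu> n) n = 1" by (simp add: eq S)
  have "degree (opuc \<mu> n) \<le> n" by (intro degree_le) (simp add: eq S)
  moreover have "n \<le> degree (opuc \<mu> n)" using n by (intro le_degree) simp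
  ultimately show ?case using n by simp
qed

lemma poly_opuc_star:
  assumes "z \<noteq> 0"
  shows "poly (opuc_star \<mu> n) z = z ^ n * cnj (poly (opuc \<mu> n) (1 / cnj z))"
proof -
  have "poly (opuc_star \<mu> n) z = cnj (poly (reflect_poly (opuc \<mu> n)) (cnj z))"
    by (simp add: opuc_star_def flip: poly_cnj)
  also have "\<dots> = cnj (cnj z ^ n * poly (opuc \<mu> n) (inverse (cnj z)))"
    using assms by (subst poly_reflect_poly_nz) (auto simp: opuc_degree_monic)
  finally show ?thesis by (simp add: inverse_eq_divide)
qed

definition opuc_norm2 :: "complex measure \<Rightarrow> nat \<Rightarrow> real" where
  "opuc_norm2 \<mu> n = (LINT \<zeta>|\<mu>. (cmod (poly (opuc \<mu> n) \<zeta>))\<^sup>2)"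

definition verblunsky :: "complex measure \<Rightarrow> nat \<Rightarrow> complex" where
  "verblunsky \<mu> n = poly (opuc \<mu> n) 0"

definition caratheodory :: "complex measure \<Rightarrow> complex \<Rightarrow> complex" where
  "caratheodory \<mu> z = (LINT \<zeta>|\<mu>. (\<zeta> + z) / (\<zeta> - z))"

text \<open>
  The functions below are used for \<open>n \<ge> 1\<close> only, and the last two only off the unit circle.
\<close>

definition assoc_poly :: "complex measure \<Rightarrow> nat \<Rightarrow> complex \<Rightarrow> complex" where
  "assoc_poly \<mu> n z =
     (LINT \<zeta>|\<mu>. (\<zeta> + z) / (\<zeta> - z) * (poly (opuc \<mu> n) \<zeta> - poly (opuc \<mu> n) z))"

definition assoc_poly_star :: "complex measure \<Rightarrow> nat \<Rightarrow> complex \<Rightarrow> complex" where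
  "assoc_poly_star \<mu> n z =
     - (LINT \<zeta>|\<mu>. (\<zeta> + z) / (\<zeta> - z) *
          (z ^ n * cnj (poly (opuc \<mu> n) \<zeta>) - poly (opuc_star \<mu> n) z))"

definition eps :: "complex measure \<Rightarrow> nat \<Rightarrow> complex \<Rightarrow> complex" where
  "eps \<mu> n z = assoc_poly \<mu> n z + caratheodory \<mu> z * poly (opuc \<mu> n) z"

definition eps_star :: "complex measure \<Rightarrow> nat \<Rightarrow> complex \<Rightarrow> complex" where
  "eps_star \<mu> n z = assoc_poly_star \<mu> n z - caratheodory \<mu> z * poly (opuc_star \<mu> n) z"

text \<open>The points \<open>z \<noteq> 0\<close> for which \<open>z\<close> and \<open>q z\<close> lie strictly on the same side of the circle.\<close>

definition same_side :: "real \<Rightarrow> complex set" where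
  "same_side q = {z. 0 < cmod z \<and> cmod z < 1} \<union> {z. 1 / q < cmod z}"

definition is_Theta ::
  "real \<Rightarrow> complex poly \<Rightarrow> complex poly \<Rightarrow> complex measure \<Rightarrow> nat \<Rightarrow> complex poly \<Rightarrow> bool" where
  "is_Theta q V W \<mu> n \<Theta> \<longleftrightarrow>
     (\<forall>z\<in>same_side q.
        2 * verblunsky \<mu> (n+1) * of_real (opuc_norm2 \<mu> n) * z ^ n * poly \<Theta> z =
        poly W z * eps \<mu> n (of_real q * z) * poly (opuc \<mu> n) z -
        poly V z * eps \<mu> n z * poly (opuc \<mu> n) (of_real q * z))"

definition is_Omega ::
  "real \<Rightarrow> complex poly \<Rightarrow> complex poly \<Rightarrow> complex measure \<Rightarrow> nat \<Rightarrow> complex poly \<Rightarrow> bool" where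
  "is_Omega q V W \<mu> n \<Omega> \<longleftrightarrow>
     (\<forall>z\<in>same_side q.
        2 * verblunsky \<mu> (n+1) * of_real (opuc_norm2 \<mu> n) * z ^ n * poly \<Omega> z =
        poly W z * eps \<mu> n (of_real q * z) * poly (opuc \<mu> (n+1)) z -
        poly V z * eps \<mu> (n+1) z * poly (opuc \<mu> n) (of_real q * z))"

definition Y_mat :: "complex measure \<Rightarrow> (complex \<Rightarrow> complex) \<Rightarrow> nat \<Rightarrow> complex \<Rightarrow> complex^2^2" where
  "Y_mat \<mu> w n z =
     vector [vector [poly (opuc \<mu> n) z, eps \<mu> n z / w z],
             vector [poly (opuc_star \<mu> n) z, - (eps_star \<mu> n z / w z)]]"

definition B_mat :: "complex measure \<Rightarrow> nat \<Rightarrow> complex \<Rightarrow> complex^2^2" where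
  "B_mat \<mu> n z =
     vector [vector [z, verblunsky \<mu> (n+1)],
             vector [z * cnj (verblunsky \<mu> (n+1)), 1]]"

definition A_mat ::
  "complex measure \<Rightarrow> nat \<Rightarrow> complex poly \<Rightarrow> complex poly \<Rightarrow> complex poly \<Rightarrow> complex poly
     \<Rightarrow> complex \<Rightarrow> complex^2^2" where
  "A_mat \<mu> n \<Theta> \<Omega> \<Theta>s \<Omega>s z =
     vector [vector [poly \<Omega> z - z * poly \<Theta> z, - verblunsky \<mu> (n+1) * poly \<Theta> z],
             vector [- z * cnj (verblunsky \<mu> (n+1)) * poly \<Theta>s z, poly \<Omega>s z - poly \<Theta>s z]]"

text \<open>
  The identity \<open>Y\<^sub>n(qz) = V(z)\<^sup>-\<^sup>1 A(z) Y\<^sub>n(z)\<close> of meromorphic functions, read pointwise wherever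
  none of the denominators \<open>V(z)\<close>, \<open>w(z)\<close>, \<open>w(qz)\<close> vanishes. The scalar factor is a scalar matrix.
\<close>

definition q_difference_system ::
  "real \<Rightarrow> complex poly \<Rightarrow> complex measure \<Rightarrow> (complex \<Rightarrow> complex) \<Rightarrow> nat
     \<Rightarrow> (complex \<Rightarrow> complex^2^2) \<Rightarrow> bool" where
  "q_difference_system q V \<mu> w n A \<longleftrightarrow>
     (\<forall>z\<in>same_side q. poly V z \<noteq> 0 \<longrightarrow> w z \<noteq> 0 \<longrightarrow> w (of_real q * z) \<noteq> 0 \<longrightarrow>
        Y_mat \<mu> w n (of_real q * z) = mat (1 / poly V z) ** A z ** Y_mat \<mu> w n z)"

end

theory Submission
  imports Defs
begin

text \<open>
  On the circle \<open>d\<mu> = w(\<zeta>) d\<zeta> / (i\<zeta>)\<close>, so \<open>\<epsilon>\<^sub>n\<close> and \<open>\<epsilon>\<^sub>n\<^sup>*\<close> are, up to the factor \<open>z\<^sup>n\<close> and a constant,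
  Cauchy transforms of \<open>\<zeta>\<^sup>-\<^sup>n \<phi>\<^sub>n(\<zeta>) w(\<zeta>)\<close> and \<open>\<zeta>\<^sup>-\<^sup>n \<phi>\<^sub>n\<^sup>*(\<zeta>) w(\<zeta>)\<close>. Since \<open>w\<close> is holomorphic in \<open>\<complex>\<^sup>*\<close>, each transform
  jumps across the circle by \<open>2\<pi>i\<close> times the transformed function. In a combination such as
  \<open>W(z) \<epsilon>\<^sub>n(qz) \<phi>\<^sub>n(z) - V(z) \<epsilon>\<^sub>n(z) \<phi>\<^sub>n(qz)\<close> the jumps cancel because \<open>W(z) w(qz) = V(z) w(z)\<close>, so the
  combination divided by \<open>z\<^sup>n\<close> is entire; orthogonality makes the transforms decay at infinity, and
  Liouville's theorem gives a polynomial with the stated degree bound. All four entries of \<open>A\<^sub>n\<close> arise in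
  this way, and so does \<open>det Y\<^sub>n = - 2\<sigma>\<^sub>n z\<^sup>n / w(z)\<close> (with \<open>q = V = W = 1\<close>). As \<open>Y\<^sub>n(z)\<close> is therefore
  invertible at generic \<open>z\<close>, it can be cancelled in the compatibility relation, which then extends from an open set to all \<open>z\<close>.
\<close>

section \<open>Cauchy transforms on circles\<close>

text \<open>The customary factor \<open>1 / (2 * pi * \<i>)\<close> is left out, so jumps carry
  \<open>2 * pi * \<i>\<close>. The radius is a parameter because transforms on the unit circle are
  later compared with those on a larger circle.\<close>

definition cauchy_transform :: "real \<Rightarrow> (complex \<Rightarrow> complex) \<Rightarrow> complex \<Rightarrow> complex" where
  "cauchy_transform R f z = contour_integral (circlepath 0 R) (\<lambda>\<zeta>. f \<zeta> / (\<zeta> - z))"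

lemma cauchy_kernel_integrable:
  assumes "0 < R" "continuous_on (sphere 0 R) f" "cmod z \<noteq> R"
  shows "(\<lambda>\<zeta>. f \<zeta> / (\<zeta> - z)) contour_integrable_on circlepath 0 R"
  using assms
  by (intro contour_integrable_continuous_circlepath continuous_intros) auto

lemma circlepath_integrable:
  assumes "0 < R" "continuous_on (sphere 0 R) f"
  shows "f contour_integrable_on circlepath 0 R"
  using assms by (intro contour_integrable_continuous_circlepath) auto

lemma cauchy_transform_holomorphic:
  assumes "0 < R" "continuous_on (sphere 0 R) f"
  shows "cauchy_transform R f holomorphic_on {z. cmod z \<noteq> R}"
proof -
  have im: "path_image (circlepath 0 R) = sphere 0 R"
    using assms by simp
  have "cauchy_transform R f field_differentiable at z" if z: "cmod z \<noteq> R" for z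
  proof -
    \<comment> \<open>Differentiation under the integral sign: the kernel has exponent 1 and its
      derivative has exponent 2.\<close>
    have "(cauchy_transform R f has_field_derivative
        (of_nat 1 * contour_integral (circlepath 0 R) (\<lambda>u. f u / (u - z) ^ Suc 1))) (at z)"
    proof (rule Cauchy_next_derivative(2)[where S = UNIV and B = "2 * pi * \<bar>R\<bar>"])
      show "continuous_on (path_image (circlepath 0 R)) f"
        using assms by simp
      show "((\<lambda>u. f u / (u - w) ^ 1) has_contour_integral cauchy_transform R f w) (circlepath 0 R)"
        if "w \<in> UNIV - path_image (circlepath 0 R)" for w
        unfolding cauchy_transform_def power_one_right using assms that
        by (intro has_contour_integral_integral cauchy_kernel_integrable) auto
    qed (use assms z in \<open>auto simp: vector_derivative_circlepath norm_mult\<close>)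
    then show ?thesis
      unfolding field_differentiable_def by blast
  qed
  then show ?thesis
    by (auto simp: holomorphic_on_def intro: field_differentiable_at_within)
qed

lemma cauchy_transform_holomorphic_comp [holomorphic_intros]:
  assumes "0 < R" "continuous_on (sphere 0 R) f" "g holomorphic_on A"
    "\<And>z. z \<in> A \<Longrightarrow> cmod (g z) \<noteq> R"
  shows "(\<lambda>z. cauchy_transform R f (g z)) holomorphic_on A"
  using holomorphic_on_compose_gen[OF assms(3) cauchy_transform_holomorphic[OF assms(1,2)]] assms(4)
  by (auto simp: o_def)

lemma cauchy_transform_add:
  assumes "0 < R" "continuous_on (sphere 0 R) f" "continuous_on (sphere 0 R) g" "cmod z \<noteq> R"
  shows "cauchy_transform R (\<lambda>\<zeta>. f \<zeta> + g \<zeta>) z = cauchy_transform R f z + cauchy_transform R g z"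
  unfolding cauchy_transform_def add_divide_distrib
  using assms by (intro contour_integral_add cauchy_kernel_integrable)

lemma cauchy_transform_cmult:
  assumes "0 < R" "continuous_on (sphere 0 R) f" "cmod z \<noteq> R"
  shows "cauchy_transform R (\<lambda>\<zeta>. c * f \<zeta>) z = c * cauchy_transform R f z"
  unfolding cauchy_transform_def times_divide_eq_right[symmetric]
  using assms by (intro contour_integral_lmul cauchy_kernel_integrable)

text \<open>Write \<open>\<zeta> / (\<zeta> - z)\<close> as
  \<open>1 + z / (\<zeta> - z)\<close>.\<close>

lemma cauchy_transform_mult_var:
  assumes "0 < R" "continuous_on (sphere 0 R) f" "cmod z \<noteq> R"
  shows "cauchy_transform R (\<lambda>\<zeta>. \<zeta> * f \<zeta>) z =
           z * cauchy_transform R f z + contour_integral (circlepath 0 R) f"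
proof -
  have "cauchy_transform R (\<lambda>\<zeta>. \<zeta> * f \<zeta>) z =
      contour_integral (circlepath 0 R) (\<lambda>\<zeta>. z * (f \<zeta> / (\<zeta> - z)) + f \<zeta>)"
    unfolding cauchy_transform_def
  proof (rule contour_integral_cong[OF refl])
    fix \<zeta> assume "\<zeta> \<in> path_image (circlepath 0 R)"
    then have "\<zeta> \<noteq> z" using assms by auto
    then show "\<zeta> * f \<zeta> / (\<zeta> - z) = z * (f \<zeta> / (\<zeta> - z)) + f \<zeta>"
      by (simp add: field_simps)
  qed
  also have "\<dots> = z * cauchy_transform R f z + contour_integral (circlepath 0 R) f"
    unfolding cauchy_transform_def
    using cauchy_kernel_integrable[OF assms] circlepath_integrable[OF assms(1,2)]
    by (simp only: contour_integral_add contour_integral_lmul contour_integrable_lmul)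
  finally show ?thesis .
qed

text \<open>\<open>cauchy_transform_mult_var\<close> iterated \<open>n\<close> times. The subtracted
  integrals are moments, and orthogonality will remove most of them.\<close>

lemma cauchy_transform_power_shift:
  assumes "0 < R" "continuous_on (sphere 0 R) f" "cmod z \<noteq> R"
  shows "z ^ n * cauchy_transform R (\<lambda>\<zeta>. f \<zeta> / \<zeta> ^ n) z =
           cauchy_transform R f z -
           (\<Sum>j<n. z ^ j * contour_integral (circlepath 0 R) (\<lambda>\<zeta>. f \<zeta> / \<zeta> ^ Suc j))"
proof (induction n)
  case 0
  then show ?case by simp
next
  case (Suc n)
  have c: "continuous_on (sphere 0 R) (\<lambda>\<zeta>. f \<zeta> / \<zeta> ^ k)" for k
    using assms by (intro continuous_intros) auto
  have "cauchy_transform R (\<lambda>\<zeta>. f \<zeta> / \<zeta> ^ n) z = cauchy_transform R (\<lambda>\<zeta>. \<zeta> * (f \<zeta> / \<zeta> ^ Suc n)) z"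
    unfolding cauchy_transform_def
    by (rule contour_integral_cong[OF refl]) (use assms in auto)
  also have "\<dots> = z * cauchy_transform R (\<lambda>\<zeta>. f \<zeta> / \<zeta> ^ Suc n) z +
      contour_integral (circlepath 0 R) (\<lambda>\<zeta>. f \<zeta> / \<zeta> ^ Suc n)"
    by (rule cauchy_transform_mult_var[OF assms(1) c assms(3)])
  finally have e: "cauchy_transform R (\<lambda>\<zeta>. f \<zeta> / \<zeta> ^ n) z = \<dots>" .
  show ?case
    using Suc.IH unfolding e by (simp add: algebra_simps del: power_Suc) (simp add: algebra_simps)
qed

text \<open>The integrand is singular at \<open>0\<close> and \<open>z\<close> only. The residue at
  \<open>0\<close> does not depend on \<open>R\<close>, so the transforms for two radii agree unless
  \<open>z\<close> lies between the circles, where they differ by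
  \<open>2 * pi * \<i> * f z\<close>.\<close>

lemma cauchy_transform_residues:
  assumes "f holomorphic_on (UNIV - {0})" "0 < R" "cmod z \<noteq> R" "z \<noteq> 0"
  shows "cauchy_transform R f z = 2 * pi * \<i> * residue (\<lambda>\<zeta>. f \<zeta> / (\<zeta> - z)) 0 +
           (if cmod z < R then 2 * pi * \<i> * f z else 0)"
proof -
  have w: "winding_number (circlepath 0 R) u = (if cmod u < R then 1 else 0)"
    if "cmod u \<noteq> R" for u
  proof (cases "cmod u < R")
    case True
    then show ?thesis by (simp add: winding_number_circlepath)
  next
    case False
    then have "winding_number (circlepath 0 R) u = 0"
      using assms(2) that
      by (intro winding_number_zero_outside[of _ "cball 0 R"]) auto
    then show ?thesis using False by simp
  qed
  have r: "residue (\<lambda>\<zeta>. f \<zeta> / (\<zeta> - z)) z = f z"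
    by (rule residue_simple[where s = "UNIV - {0}"]) (use assms in auto)
  have "cauchy_transform R f z =
      2 * pi * \<i> * (\<Sum>p\<in>{0, z}. winding_number (circlepath 0 R) p * residue (\<lambda>\<zeta>. f \<zeta> / (\<zeta> - z)) p)"
    unfolding cauchy_transform_def
    by (rule Residue_theorem[where S = UNIV])
      (use assms in \<open>auto intro!: holomorphic_intros elim: holomorphic_on_subset\<close>)
  then show ?thesis
    using assms by (auto simp: w r algebra_simps)
qed

section \<open>Growth at infinity and Liouville's theorem\<close>

lemma cauchy_transform_bigo:
  assumes "0 < R" "continuous_on (sphere 0 R) f"
  shows "cauchy_transform R f \<in> O[at_infinity](\<lambda>z. inverse z)"
proof -
  have "bounded (f ` sphere 0 R)"
    using assms compact_continuous_image compact_imp_bounded compact_sphere by blast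
  then obtain M where M: "\<And>x. cmod x = R \<Longrightarrow> cmod (f x) \<le> M" "0 < M"
    by (fastforce simp: bounded_pos)
  show ?thesis
  \<comment> \<open>For \<open>2 * R \<le> cmod z\<close> the denominator is at least
    \<open>cmod z / 2\<close>; the constant is \<open>2 * M\<close> times the length of the
    circle.\<close>
  proof (rule bigoI[where c = "2 * M * (2 * pi * R)"])
    have "cmod (cauchy_transform R f z) \<le> 2 * M * (2 * pi * R) * cmod (inverse z)"
      if z: "2 * R \<le> cmod z" for z
    proof -
      have z0: "cmod z \<noteq> R" "0 < cmod z" using z assms(1) by linarith+
      have "cmod (cauchy_transform R f z) \<le> (2 * M / cmod z) * (2 * pi * R)"
        unfolding cauchy_transform_def
      proof (rule has_contour_integral_bound_circlepath)
        show "((\<lambda>\<zeta>. f \<zeta> / (\<zeta> - z)) has_contour_integral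
          contour_integral (circlepath 0 R) (\<lambda>\<zeta>. f \<zeta> / (\<zeta> - z))) (circlepath 0 R)"
          using assms z0 by (intro has_contour_integral_integral cauchy_kernel_integrable)
        fix x :: complex assume x: "cmod (x - 0) = R"
        have "cmod z / 2 \<le> cmod (x - z)"
          using norm_triangle_ineq2[of z x] x z by (simp add: norm_minus_commute)
        then have "cmod (f x) / cmod (x - z) \<le> M / (cmod z / 2)"
          using M x z0 by (intro frac_le) auto
        then show "cmod (f x / (x - z)) \<le> 2 * M / cmod z"
          by (simp add: norm_divide mult.commute)
      qed (use assms M z0 in auto)
      then show ?thesis
        by (simp add: norm_inverse divide_inverse mult_ac)
    qed
    then show "\<forall>\<^sub>F z in at_infinity. cmod (cauchy_transform R f z) \<le> 2 * M * (2 * pi * R) * cmod (inverse z)"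
      unfolding eventually_at_infinity by blast
  qed
qed

lemma poly_bigo_at_infinity:
  fixes p :: "complex poly"
  assumes "degree p \<le> d"
  shows "poly p \<in> O[at_infinity](\<lambda>z. z ^ d)"
proof -
  have "(\<lambda>z. \<Sum>i\<le>degree p. coeff p i * z ^ i) \<in> O[at_infinity](\<lambda>z. z ^ d)"
  proof (intro big_sum_in_bigo)
    fix i assume "i \<in> {..degree p}"
    then have "\<forall>\<^sub>F z in at_infinity. cmod (coeff p i * z ^ i) \<le> cmod (coeff p i) * cmod (z ^ d)"
      unfolding eventually_at_infinity using assms
      by (intro exI[of _ 1]) (auto simp: norm_mult norm_power intro!: mult_left_mono power_increasing)
    then show "(\<lambda>z. coeff p i * z ^ i) \<in> O[at_infinity](\<lambda>z. z ^ d)"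
      by (rule bigoI)
  qed
  then show ?thesis
    by (simp add: poly_altdef[abs_def])
qed

text \<open>Bounding \<open>z * h z\<close> instead of \<open>h z\<close> lets \<open>m = 0\<close>
  stand for decay at infinity, which forces \<open>h\<close> to be zero. The disjunction in the
  conclusion thus means degree at most \<open>m - 1\<close>, including the value -1.\<close>

lemma entire_bigo_imp_poly:
  fixes h :: "complex \<Rightarrow> complex"
  assumes "h holomorphic_on UNIV" "(\<lambda>z. z * h z) \<in> O[at_infinity](\<lambda>z. z ^ m)"
  shows "\<exists>P. (\<forall>z. h z = poly P z) \<and> (P = 0 \<or> degree P < m)"
proof -
  obtain c where "\<forall>\<^sub>F z in at_infinity. cmod (z * h z) \<le> c * cmod (z ^ m)"
    using assms(2) by (elim landau_o.bigE)
  then obtain A where A: "cmod (z * h z) \<le> c * cmod z ^ m" if "A \<le> cmod z" for z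
    unfolding eventually_at_infinity by (auto simp: norm_power)
  define b where "b k = (deriv ^^ k) (\<lambda>z. z * h z) 0 / fact k" for k
  define Q where "Q = (\<Sum>k\<le>m. monom (b k) k)"
  have hol: "(\<lambda>z. z * h z) holomorphic_on UNIV"
    using assms(1) by (intro holomorphic_intros)
  have Q: "z * h z = poly Q z" for z
    using Liouville_polynomial[where f = "\<lambda>z. z * h z" and A = A and B = c and n = m and \<xi> = z] A hol
    by (auto simp: Q_def b_def poly_sum poly_monom)
  have dQ: "degree Q \<le> m"
    unfolding Q_def by (intro degree_sum_le) (auto intro: degree_monom_le order_trans)
  \<comment> \<open>\<open>Q\<close> vanishes at \<open>0\<close>, so the variable divides out. The
    quotient agrees with \<open>h\<close> off \<open>0\<close>, and at \<open>0\<close> by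
    continuity.\<close>
  obtain P where P: "Q = pCons 0 P"
    using Q[of 0] by (cases Q) auto
  have eq: "h z = poly P z" if "z \<noteq> 0" for z
    using Q[of z] that by (simp add: P)
  have lim: "(h \<longlongrightarrow> h 0) (at 0)" "(poly P \<longlongrightarrow> poly P 0) (at 0)"
    using assms(1) holomorphic_on_imp_continuous_on[of h UNIV]
    by (auto simp: continuous_on_eq_continuous_at isCont_def[symmetric])
  have "(h \<longlongrightarrow> poly P 0) (at 0)"
    using lim(2) by (rule Lim_transform_eventually) (auto simp: eq eventually_at intro!: exI[of _ 1])
  then have "h 0 = poly P 0"
    using lim(1) by (intro tendsto_unique) auto
  with eq have "h z = poly P z" for z by (cases "z = 0") auto
  moreover have "P = 0 \<or> degree P < m"
    using dQ by (auto simp: P split: if_splits)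
  ultimately show ?thesis by blast
qed

text \<open>Enlarging the radius changes the transform of \<open>f\<close> at a point \<open>z\<close> between the two circles
  by the residue \<open>2\<pi>i f(z)\<close>; hypothesis \<open>jump\<close> makes these contributions cancel.\<close>

lemma cauchy_transform_combination_poly:
  fixes a b f g :: "complex \<Rightarrow> complex" and q :: real
  assumes q: "0 < q" "q \<le> 1"
    and f: "f holomorphic_on (UNIV - {0})" and g: "g holomorphic_on (UNIV - {0})"
    and a: "a holomorphic_on UNIV" and b: "b holomorphic_on UNIV"
    and jump: "\<And>z::complex. z \<noteq> 0 \<Longrightarrow> a z * f (q * z) = b z * g z"
    and growth: "(\<lambda>z::complex. z * (a z * cauchy_transform 1 f (q * z) - b z * cauchy_transform 1 g z))
      \<in> O[at_infinity](\<lambda>z. z ^ m)"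
  shows "\<exists>P. (P = 0 \<or> degree P < m) \<and>
    (\<forall>z::complex. cmod z < 1 \<or> 1 / q < cmod z \<longrightarrow>
       poly P z = a z * cauchy_transform 1 f (q * z) - b z * cauchy_transform 1 g z)"
proof -
  define G where "G R z = a z * cauchy_transform R f (q * z) - b z * cauchy_transform R g z"
    for R and z :: complex
  \<comment> \<open>Any radius above \<open>1 / q\<close> would do: the disc has to overlap the
    region \<open>1 / q < cmod z\<close>.\<close>
  define R where "R = 2 / q"
  have R: "1 < R" "1 / q < R" "0 < R"
    using q by (auto simp: R_def field_simps)
  have q1: "1 \<le> 1 / q" using q by simp
  have cont: "continuous_on (sphere 0 r) f" "continuous_on (sphere 0 r) g" if "0 < r" for r
    using that f g by (auto intro!: holomorphic_on_imp_continuous_on elim!: holomorphic_on_subset)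
  have nq: "cmod (of_real q * z) = q * cmod z" for z
    using q by (simp add: norm_mult)
  \<comment> \<open>If \<open>cmod z < 1\<close>, both \<open>z\<close> and \<open>q * z\<close> are
    inside both circles and the residues agree. If \<open>1 / q < cmod z < R\<close>, both are
    between the circles, and the two extra residues cancel by \<open>jump\<close>.\<close>
  have eq_nz: "G R z = G 1 z" if z: "z \<noteq> 0" "cmod z < R" "cmod z < 1 \<or> 1 / q < cmod z" for z
  proof -
    have lt: "q * cmod z \<le> cmod z" using q by (simp add: mult_left_le_one_le)
    consider "cmod z < 1" | "1 / q < cmod z" using z by blast
    then show ?thesis
    proof cases
      case 1
      moreover have "q * cmod z < 1" "q * cmod z < R"
        using 1 lt R by linarith+
      ultimately show ?thesis
        using z R q unfolding G_def
        by (simp add: cauchy_transform_residues[OF f] cauchy_transform_residues[OF g] nq)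
    next
      case 2
      then have "1 < q * cmod z" "1 < cmod z" using q lt by (auto simp: field_simps)
      moreover have "q * cmod z < R" using lt z by linarith
      ultimately have
        "cauchy_transform R f (q * z) = cauchy_transform 1 f (q * z) + 2 * pi * \<i> * f (q * z)"
        "cauchy_transform R g z = cauchy_transform 1 g z + 2 * pi * \<i> * g z"
        using z R q
        by (simp_all add: cauchy_transform_residues[OF f] cauchy_transform_residues[OF g] nq)
      then show ?thesis
        using jump[OF z(1)] unfolding G_def by algebra
    qed
  qed
  have hol: "G R holomorphic_on ball 0 R"
  proof -
    have "q * cmod z < R" if "cmod z < R" for z :: complex
      using that q mult_left_le_one_le[of "cmod z" q] by auto
    then show ?thesis
      unfolding G_def using cont[OF R(3)] R
      by (intro holomorphic_intros holomorphic_on_subset[OF a] holomorphic_on_subset[OF b])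
        (force simp: nq)+
  qed
  have hol1: "G 1 holomorphic_on {z. cmod z < 1 \<or> 1 / q < cmod z}"
  proof -
    have "q * cmod z \<noteq> 1" "cmod z \<noteq> 1" if "cmod z < 1 \<or> 1 / q < cmod z" for z :: complex
      using that q q1 mult_left_le_one_le[of "cmod z" q] by (auto simp: field_simps)
    then show ?thesis
      unfolding G_def using cont[of 1]
      by (intro holomorphic_intros holomorphic_on_subset[OF a] holomorphic_on_subset[OF b])
        (force simp: nq)+
  qed
  \<comment> \<open>The residue formula excludes \<open>z = 0\<close>, where the equality is
    recovered as a limit.\<close>
  have eq: "G R z = G 1 z" if z: "cmod z < R" "cmod z < 1 \<or> 1 / q < cmod z" for z
  proof (cases "z = 0")
    case True
    have "ball 0 1 \<subseteq> {z::complex. cmod z < 1 \<or> 1 / q < cmod z}" by auto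
    note hol2 = holomorphic_on_subset[OF hol1 this]
    have "((\<lambda>z. G R z) \<longlongrightarrow> G R 0) (at 0)" "((\<lambda>z. G 1 z) \<longlongrightarrow> G 1 0) (at 0)"
      using holomorphic_on_imp_continuous_on[OF hol]
        holomorphic_on_imp_continuous_on[OF hol2] R
      by (auto simp: continuous_on_eq_continuous_at isCont_def)
    moreover have "\<forall>\<^sub>F z in at 0. G R z = G 1 z"
      unfolding eventually_at using R by (intro exI[of _ 1]) (auto intro!: eq_nz)
    ultimately have "((\<lambda>z. G 1 z) \<longlongrightarrow> G R 0) (at 0)"
      by (blast intro: Lim_transform_eventually)
    with \<open>((\<lambda>z. G 1 z) \<longlongrightarrow> G 1 0) (at 0)\<close> show ?thesis
      using True LIM_unique by blast
  qed (use z eq_nz in auto)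
  \<comment> \<open>The entire extension: \<open>G R\<close> bridges the annulus between radii
    \<open>1\<close> and \<open>1 / q\<close>. The two open pieces on which \<open>h\<close> is
    holomorphic cover the plane because \<open>1 / q < R\<close>.\<close>
  define h where "h z = (if cmod z < R then G R z else G 1 z)" for z
  have h: "h z = G 1 z" if "cmod z < 1 \<or> 1 / q < cmod z" for z
    using eq that by (auto simp: h_def)
  have "h holomorphic_on (ball 0 R \<union> - cball 0 (1 / q))"
  proof (rule holomorphic_on_Un)
    show "h holomorphic_on ball 0 R"
      by (rule holomorphic_transform[OF hol]) (auto simp: h_def)
    show "h holomorphic_on - cball 0 (1 / q)"
      by (rule holomorphic_transform[OF holomorphic_on_subset[OF hol1]]) (auto simp: h)
  qed auto
  also have "ball 0 R \<union> - cball 0 (1 / q) = UNIV"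
    using R by auto
  finally have "h holomorphic_on UNIV" .
  moreover have "(\<lambda>z. z * h z) \<in> O[at_infinity](\<lambda>z. z ^ m)"
  proof -
    have "\<forall>\<^sub>F z in at_infinity. z * h z = z * G 1 z"
      unfolding eventually_at_infinity using R by (intro exI[of _ R]) (auto simp: h)
    then show ?thesis
      using growth unfolding G_def by (subst landau_o.big.in_cong) auto
  qed
  ultimately obtain P where "\<forall>z. h z = poly P z" "P = 0 \<or> degree P < m"
    using entire_bigo_imp_poly by blast
  then show ?thesis
    using h unfolding G_def by (intro exI[of _ P]) auto
qed

section \<open>Nonvanishing of holomorphic functions and matrices\<close>

lemma connected_punctured_plane: "connected (UNIV - {0 :: complex})"
  using connected_punctured_universe[of "0::complex"] by (simp add: Compl_eq_Diff_UNIV)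

text \<open>The identity theorem. Giving openness together with nonemptiness allows the zeros of
  several functions to be removed one after another.\<close>

lemma holomorphic_nonzero_on_open:
  assumes "f holomorphic_on S" "open S" "connected S" "z0 \<in> S" "f z0 \<noteq> 0"
    and "open U" "U \<subseteq> S" "U \<noteq> {}"
  shows "open {z\<in>U. f z \<noteq> 0}" "{z\<in>U. f z \<noteq> 0} \<noteq> {}"
proof -
  have "continuous_on U f"
    using assms(1,7) holomorphic_on_imp_continuous_on holomorphic_on_subset by blast
  then have "open (U \<inter> f -` (- {0}))"
    using assms(6) by (intro continuous_open_preimage) auto
  also have "U \<inter> f -` (- {0}) = {z\<in>U. f z \<noteq> 0}" by auto
  finally show "open {z\<in>U. f z \<noteq> 0}" .
  show "{z\<in>U. f z \<noteq> 0} \<noteq> {}"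
  proof
    assume "{z\<in>U. f z \<noteq> 0} = {}"
    then have "f z0 = 0"
      using assms by (intro analytic_continuation_open[of U S f "\<lambda>_. 0" z0]) auto
    then show False using assms(5) by contradiction
  qed
qed

lemma poly_nonzero_on_open:
  fixes p :: "complex poly"
  assumes "p \<noteq> 0" "open U" "U \<noteq> {}"
  shows "open {z\<in>U. poly p z \<noteq> 0}" "{z\<in>U. poly p z \<noteq> 0} \<noteq> {}"
proof -
  obtain z0 where z0: "poly p z0 \<noteq> 0"
    using assms(1) poly_all_0_iff_0[of p] by blast
  have "poly p holomorphic_on UNIV"
    by (intro holomorphic_intros)
  from holomorphic_nonzero_on_open[OF this open_UNIV connected_UNIV UNIV_I z0 assms(2) subset_UNIV assms(3)]
  show "open {z\<in>U. poly p z \<noteq> 0}" "{z\<in>U. poly p z \<noteq> 0} \<noteq> {}" .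
qed

lemma mat_matrix_mult_commute:
  fixes X :: "'a::comm_semiring_1^'n^'n"
  shows "mat c ** X = X ** mat c"
  by (simp add: vec_eq_iff matrix_matrix_mult_def mat_def mult_delta_left mult_delta_right mult.commute)

lemma mat_mult_mat: "mat a ** mat b = (mat (a * b) :: 'a::semiring_1^'n^'n)"
  by (simp add: vec_eq_iff matrix_matrix_mult_def mat_def mult_delta_left)

lemma matrix_2_eqI:
  fixes A B :: "'a^2^2"
  assumes "A $ 1 $ 1 = B $ 1 $ 1" "A $ 1 $ 2 = B $ 1 $ 2" "A $ 2 $ 1 = B $ 2 $ 1" "A $ 2 $ 2 = B $ 2 $ 2"
  shows "A = B"
  using assms by (simp add: vec_eq_iff forall_2)

lemmas matrix_2_simps = matrix_matrix_mult_def sum_2 vector_2 mat_def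

lemma matrix_mult_right_cancel:
  fixes A B X :: "'a::field^'n^'n"
  assumes "A ** X = B ** X" "det X \<noteq> 0"
  shows "A = B"
proof -
  obtain X' where "X ** X' = mat 1"
    using assms(2) invertible_det_nz[of X] by (auto simp: invertible_def)
  then show ?thesis
    using assms(1) by (metis matrix_mul_assoc matrix_mul_rid)
qed

section \<open>Orthogonal polynomials for a weight on the circle\<close>

lemma borel_measurable_poly [measurable]: "poly p \<in> borel_measurable borel" for p :: "complex poly"
  by (intro borel_measurable_continuous_onI continuous_intros)

lemma borel_measurable_cnj [measurable]: "cnj \<in> borel_measurable borel"
  by (intro borel_measurable_continuous_onI continuous_intros)

locale circle_weight =
  fixes w :: "complex \<Rightarrow> complex"
  assumes holomorphic: "w holomorphic_on (UNIV - {0})"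
    and nonneg: "w ` sphere 0 1 \<subseteq> \<real>\<^sub>\<ge>\<^sub>0"
    and nontrivial: "\<exists>z. z \<noteq> 0 \<and> w z \<noteq> 0"
begin

abbreviation \<mu> :: "complex measure" where "\<mu> \<equiv> circle_measure w"
abbreviation ip :: "complex poly \<Rightarrow> complex poly \<Rightarrow> complex" where "ip \<equiv> poly_inner \<mu>"
abbreviation \<phi> :: "nat \<Rightarrow> complex poly" where "\<phi> \<equiv> opuc \<mu>"
abbreviation \<phi>s :: "nat \<Rightarrow> complex poly" where "\<phi>s \<equiv> opuc_star \<mu>"
abbreviation \<alpha> :: "nat \<Rightarrow> complex" where "\<alpha> \<equiv> verblunsky \<mu>"
abbreviation \<sigma> :: "nat \<Rightarrow> real" where "\<sigma> \<equiv> opuc_norm2 \<mu>"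

section \<open>Integration against the measure\<close>

lemma continuous_on_w [continuous_intros]:
  assumes "continuous_on A g" "\<And>x. x \<in> A \<Longrightarrow> g x \<noteq> 0"
  shows "continuous_on A (\<lambda>x. w (g x))"
  using continuous_on_compose2[OF holomorphic_on_imp_continuous_on[OF holomorphic] assms(1)] assms(2)
  by (auto simp: image_subset_iff)

lemma holomorphic_on_w [holomorphic_intros]:
  assumes "g holomorphic_on A" "\<And>x. x \<in> A \<Longrightarrow> g x \<noteq> 0"
  shows "(\<lambda>x. w (g x)) holomorphic_on A"
  using holomorphic_on_compose_gen[OF assms(1) holomorphic] assms(2)
  by (auto simp: o_def image_subset_iff)

lemma w_circle:
  assumes "cmod \<zeta> = 1"
  shows "w \<zeta> = of_real (Re (w \<zeta>))" "0 \<le> Re (w \<zeta>)"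
  using nonneg assms by (auto simp: image_subset_iff nonneg_Reals_def complex_is_Real_iff complex_eq_iff)

text \<open>On the circle \<open>w\<close> is real and nonnegative, so the density
  \<open>Re (w (cis t))\<close> can be replaced by \<open>w\<close> itself; the endpoint
  \<open>2 * pi\<close> is a null set. Measurability on the plane is asked for separately because
  kernels such as \<open>(\<zeta> + z) / (\<zeta> - z)\<close> are continuous on the circle but not
  at \<open>z\<close>.\<close>

lemma integral_circle_measure:
  fixes f :: "complex \<Rightarrow> complex"
  assumes "f \<in> borel_measurable borel" "continuous_on (sphere 0 1) f"
  shows "integrable \<mu> f"
    and "(\<integral>\<zeta>. f \<zeta> \<partial>\<mu>) = integral {0..2*pi} (\<lambda>t. w (cis t) * f (cis t))"
proof -
  define v where "v t = Re (w (cis t))" for t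
  have cv: "continuous_on UNIV v"
    unfolding v_def by (intro continuous_intros) auto
  have v0: "0 \<le> v t" and wv: "w (cis t) = of_real (v t)" for t
    using w_circle[of "cis t"] by (auto simp: v_def)
  let ?M = "restrict_space lborel {0..<2*pi}"
  have mv: "v \<in> borel_measurable ?M"
    using borel_measurable_continuous_onI[OF cv]
    by (intro measurable_restrict_space1) auto
  have mcis: "cis \<in> measurable ?M borel"
    using borel_measurable_continuous_onI[of cis] continuous_on_cis[OF continuous_on_id]
    by (intro measurable_restrict_space1) auto
  have mf: "(\<lambda>t. f (cis t)) \<in> borel_measurable ?M"
    using mcis assms(1) by (rule measurable_compose)
  let ?g = "\<lambda>t. v t *\<^sub>R f (cis t)"
  have "continuous_on UNIV (\<lambda>t. f (cis t))"
    by (rule continuous_on_compose2[OF assms(2)]) (auto intro: continuous_intros)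
  then have cg: "continuous_on S ?g" for S
    using cv by (auto intro!: continuous_intros intro: continuous_on_subset)
  have "set_integrable lborel {0..2*pi} ?g"
    by (rule borel_integrable_atLeastAtMost'[OF cg])
  then have si: "set_integrable lborel {0..<2*pi} ?g"
    by (rule set_integrable_subset) auto
  have \<mu>: "\<mu> = distr (density ?M (\<lambda>t. ennreal (v t))) borel cis"
    by (simp add: circle_measure_def v_def)
  have "integrable \<mu> f \<longleftrightarrow> integrable (density ?M (\<lambda>t. ennreal (v t))) (\<lambda>t. f (cis t))"
    unfolding \<mu> using mcis assms by (intro integrable_distr_eq) auto
  also have "\<dots> \<longleftrightarrow> integrable ?M ?g"
    using mf mv v0 by (intro integrable_density) auto
  also have "\<dots> \<longleftrightarrow> set_integrable lborel {0..<2*pi} ?g"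
    unfolding set_integrable_def by (intro integrable_restrict_space) auto
  finally show "integrable \<mu> f" using si by simp
  have "(\<integral>\<zeta>. f \<zeta> \<partial>\<mu>) = (\<integral>t. f (cis t) \<partial>density ?M (\<lambda>t. ennreal (v t)))"
    unfolding \<mu> using mcis assms by (intro integral_distr) auto
  also have "\<dots> = (\<integral>t. ?g t \<partial>?M)"
    using mf mv v0 by (intro integral_density) auto
  also have "\<dots> = (LINT t:{0..<2*pi}|lborel. ?g t)"
    unfolding set_lebesgue_integral_def by (intro integral_restrict_space) auto
  also have "\<dots> = integral {0..<2*pi} ?g"
    by (rule set_borel_integral_eq_integral[OF si])
  also have "\<dots> = integral {0..2*pi} ?g"
  proof (rule integral_subset_negligible)
    have "{0..2*pi} - {0..<2*pi} = {2*pi}" by auto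
    then show "negligible ({0..2*pi} - {0..<2*pi})" by simp
  qed auto
  finally show "(\<integral>\<zeta>. f \<zeta> \<partial>\<mu>) = integral {0..2*pi} (\<lambda>t. w (cis t) * f (cis t))"
    by (simp add: wv scaleR_conv_of_real)
qed

lemma integral_circle_measure_cong:
  fixes f g :: "complex \<Rightarrow> complex"
  assumes "f \<in> borel_measurable borel" "g \<in> borel_measurable borel" "continuous_on (sphere 0 1) f"
    and eq: "\<And>\<zeta>. cmod \<zeta> = 1 \<Longrightarrow> f \<zeta> = g \<zeta>"
  shows "(\<integral>\<zeta>. f \<zeta> \<partial>\<mu>) = (\<integral>\<zeta>. g \<zeta> \<partial>\<mu>)"
proof -
  have "continuous_on (sphere 0 1) g"
    using assms(3) by (rule continuous_on_eq) (simp add: eq)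
  then show ?thesis
    using assms by (simp add: integral_circle_measure)
qed

text \<open>On the circle \<open>d\<zeta> = \<i> * \<zeta> * d\<theta>\<close>, which absorbs the
  division by \<open>\<zeta>\<close>.\<close>

lemma contour_integral_circle_measure:
  assumes "f \<in> borel_measurable borel" "continuous_on (sphere 0 1) f"
    and "\<And>\<zeta>. cmod \<zeta> = 1 \<Longrightarrow> g \<zeta> = f \<zeta> * w \<zeta> / \<zeta>"
  shows "contour_integral (circlepath 0 1) g = \<i> * (\<integral>\<zeta>. f \<zeta> \<partial>\<mu>)"
proof -
  have "contour_integral (circlepath 0 1) g = integral {0..2*pi} (\<lambda>t. \<i> * (w (cis t) * f (cis t)))"
    by (simp add: circlepath_def contour_integral_part_circlepath_eq assms(3) mult_ac)
  then show ?thesis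
    using assms by (simp add: integral_circle_measure)
qed

section \<open>The inner product and its definiteness\<close>

lemma borel_measurable_poly_inner_integrand:
  "(\<lambda>\<zeta>. poly p \<zeta> * cnj (poly r \<zeta>)) \<in> borel_measurable borel"
  by measurable

lemma integrable_poly_inner: "integrable \<mu> (\<lambda>\<zeta>. poly p \<zeta> * cnj (poly r \<zeta>))"
  by (intro integral_circle_measure borel_measurable_poly_inner_integrand continuous_intros)

lemma ip_add_left: "ip (p + r) s = ip p s + ip r s"
  unfolding poly_inner_def by (simp add: distrib_right integrable_poly_inner)

lemma ip_diff_left: "ip (p - r) s = ip p s - ip r s"
  unfolding poly_inner_def by (simp add: left_diff_distrib integrable_poly_inner)

lemma ip_smult_left: "ip (smult c p) s = c * ip p s"
  unfolding poly_inner_def by (simp add: mult.assoc)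

lemma ip_zero_left [simp]: "ip 0 s = 0"
  unfolding poly_inner_def by simp

lemma ip_sum_left: "ip (sum f A) s = (\<Sum>x\<in>A. ip (f x) s)"
  by (induction A rule: infinite_finite_induct) (simp_all add: ip_add_left)

lemma ip_commute: "ip r p = cnj (ip p r)"
  unfolding poly_inner_def Bochner_Integration.integral_cnj[symmetric] by (simp add: mult.commute)

lemma ip_add_right: "ip s (p + r) = ip s p + ip s r"
  by (subst (1 2 3) ip_commute) (simp add: ip_add_left)

lemma ip_diff_right: "ip s (p - r) = ip s p - ip s r"
  by (subst (1 2 3) ip_commute) (simp add: ip_diff_left)

lemma ip_smult_right: "ip s (smult c p) = cnj c * ip s p"
  by (subst (1 2) ip_commute) (simp add: ip_smult_left)

lemma ip_zero_right [simp]: "ip s 0 = 0"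
  by (subst ip_commute) simp

lemma ip_sum_right: "ip s (sum f A) = (\<Sum>x\<in>A. ip s (f x))"
  by (induction A rule: infinite_finite_induct) (simp_all add: ip_add_right)

text \<open>Multiplication by the variable is an isometry because
  \<open>\<zeta> * cnj \<zeta> = 1\<close> on the circle.\<close>

lemma ip_pCons_monom: "ip (pCons 0 p) (monom 1 (Suc j)) = ip p (monom 1 j)"
  unfolding poly_inner_def
proof (rule integral_circle_measure_cong)
  fix \<zeta> :: complex assume "cmod \<zeta> = 1"
  then have "\<zeta> * cnj \<zeta> = 1" by (simp add: complex_norm_square[symmetric])
  then show "poly (pCons 0 p) \<zeta> * cnj (poly (monom 1 (Suc j)) \<zeta>) =
      poly p \<zeta> * cnj (poly (monom 1 j) \<zeta>)"
    by (simp add: poly_monom)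
qed (auto intro!: borel_measurable_poly_inner_integrand continuous_intros)

text \<open>By the identity theorem the product vanishes on the whole punctured plane. Near a point
  where \<open>w\<close> is nonzero, \<open>f\<close> then has infinitely many roots.\<close>

lemma mult_w_eq_0_imp:
  fixes f :: "complex poly"
  assumes "\<And>\<zeta>. cmod \<zeta> = 1 \<Longrightarrow> poly f \<zeta> * w \<zeta> = 0"
  shows "f = 0"
proof (rule ccontr)
  assume "f \<noteq> 0"
  have zero: "poly f z * w z = 0" if "z \<noteq> 0" for z
  proof (rule analytic_continuation[where f = "\<lambda>z. poly f z * w z" and S = "UNIV - {0}"
        and U = "sphere 0 1" and \<xi> = 1])
    show "connected (UNIV - {0 :: complex})"
      by (rule connected_punctured_plane)
    \<comment> \<open>The identity theorem needs a limit point of the circle: every point of a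
      connected set with at least two points is one.\<close>
    have "connected (sphere (0::complex) 1)"
      by (rule connected_sphere) simp
    then show "(1::complex) islimpt sphere 0 1"
    proof (rule connected_imp_perfect)
      have "(1::complex) \<in> sphere 0 1" "(-1::complex) \<in> sphere 0 1" by auto
      then show "sphere (0::complex) 1 \<noteq> {a}" for a
        by (metis one_neq_neg_one singletonD)
    qed auto
  qed (use assms that in \<open>auto intro!: holomorphic_intros\<close>)
  obtain z0 where z0: "z0 \<noteq> 0" "w z0 \<noteq> 0" using nontrivial by blast
  have "isCont w z0"
    using z0 holomorphic_on_imp_continuous_on[OF holomorphic] continuous_on_eq_continuous_at[of "UNIV - {0}" w]
    by auto
  then obtain e where e: "e > 0" "\<And>y. dist z0 y < e \<Longrightarrow> w y \<noteq> 0"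
    using continuous_at_avoid[of z0 w 0] z0 by blast
  have "ball z0 e - {0} \<subseteq> {z. poly f z = 0}"
    using e(2) zero by fastforce
  moreover have "infinite (ball z0 e - {0})"
    using uncountable_infinite[OF uncountable_ball[OF e(1), of z0]] by simp
  ultimately show False
    using poly_roots_finite[OF \<open>f \<noteq> 0\<close>] finite_subset by blast
qed

text \<open>Definiteness, which keeps the Gram-Schmidt divisors nonzero: a continuous nonnegative
  integrand with integral zero vanishes, and \<open>mult_w_eq_0_imp\<close> applies.\<close>

lemma ip_self_eq_0_imp:
  assumes "ip f f = 0"
  shows "f = 0"
proof (rule mult_w_eq_0_imp)
  let ?r = "\<lambda>t. Re (w (cis t)) * (cmod (poly f (cis t)))\<^sup>2"
  have wr: "w (cis t) * (poly f (cis t) * cnj (poly f (cis t))) = of_real (?r t)" for t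
    unfolding complex_norm_square[symmetric] using w_circle[of "cis t"] by simp
  have c: "continuous_on S ?r" for S
    by (intro continuous_intros) auto
  have "ip f f = integral {0..2*pi} (\<lambda>t. of_real (?r t))"
    unfolding poly_inner_def wr[symmetric]
    by (intro integral_circle_measure borel_measurable_poly_inner_integrand continuous_intros)
  moreover have "((\<lambda>t. complex_of_real (?r t)) has_integral of_real (integral {0..2*pi} ?r)) {0..2*pi}"
    by (intro has_integral_of_real integrable_integral integrable_continuous_real c)
  ultimately have i0: "integral {0..2*pi} ?r = 0"
    using assms by (simp add: integral_unique)
  have zero: "?r t = 0" if "t \<in> {0..2*pi}" for t
  proof (rule has_integral_0_cbox_imp_0[of 0 "2*pi" ?r])
    show "(?r has_integral 0) (cbox 0 (2*pi))"
      using integrable_integral[OF integrable_continuous_real[OF c[of "{0..2*pi}"]]] i0 by simp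
    show "0 \<le> ?r x" for x using w_circle[of "cis x"] by simp
  qed (use that c pi_gt_zero in \<open>auto simp: not_le\<close>)
  fix \<zeta> :: complex assume \<zeta>: "cmod \<zeta> = 1"
  then have e: "cis (Arg2pi \<zeta>) = \<zeta>"
    using Arg2pi_eq[of \<zeta>] by (simp add: cis_conv_exp)
  have "?r (Arg2pi \<zeta>) = 0"
    using Arg2pi_ge_0[of \<zeta>] Arg2pi_lt_2pi[of \<zeta>] by (intro zero) auto
  then show "poly f \<zeta> * w \<zeta> = 0"
    using w_circle[OF \<zeta>] by (auto simp: e)
qed

section \<open>Orthogonality and norms\<close>

lemma coeff_opuc_self [simp]: "coeff (\<phi> n) n = 1"
  using opuc_degree_monic[of \<mu> n] by metis

lemma coeff_opuc_gt: "n < i \<Longrightarrow> coeff (\<phi> n) i = 0"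
  using opuc_degree_monic[of \<mu> n] by (simp add: coeff_eq_0)

lemma ip_opuc_self_nonzero: "ip (\<phi> n) (\<phi> n) \<noteq> 0"
proof
  assume "ip (\<phi> n) (\<phi> n) = 0"
  then have "\<phi> n = 0" by (rule ip_self_eq_0_imp)
  then show False using coeff_opuc_self[of n] by simp
qed

lemma opuc_orthogonal: "k < n \<Longrightarrow> ip (\<phi> n) (\<phi> k) = 0"
proof (induction n arbitrary: k rule: less_induct)
  case (less n)
  let ?c = "\<lambda>j. ip (monom 1 n) (\<phi> j) / ip (\<phi> j) (\<phi> j)"
  have "ip (\<phi> n) (\<phi> k) = ip (monom 1 n) (\<phi> k) - (\<Sum>j<n. ?c j * ip (\<phi> j) (\<phi> k))"
    by (subst opuc.simps) (simp add: ip_diff_left ip_sum_left ip_smult_left)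
  also have "(\<Sum>j<n. ?c j * ip (\<phi> j) (\<phi> k)) = (\<Sum>j<n. if j = k then ip (monom 1 n) (\<phi> k) else 0)"
  proof (rule sum.cong[OF refl])
    fix j assume "j \<in> {..<n}"
    \<comment> \<open>Conjugate symmetry makes the induction hypothesis usable whichever of
      \<open>j\<close> and \<open>k\<close> is larger.\<close>
    then have "j \<noteq> k \<Longrightarrow> ip (\<phi> j) (\<phi> k) = 0"
      using less.IH[of j k] less.IH[of k j] less.prems ip_commute[of "\<phi> j" "\<phi> k"]
      by (cases j k rule: linorder_cases) auto
    then show "?c j * ip (\<phi> j) (\<phi> k) = (if j = k then ip (monom 1 n) (\<phi> k) else 0)"
      using ip_opuc_self_nonzero[of k] by auto
  qed
  finally show ?case using less.prems by simp
qed

text \<open>Subtracting a multiple of the monic \<open>\<phi> m\<close> removes the coefficient of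
  index \<open>m\<close>, and induction lowers the bound. Phrasing the bound by coefficients covers
  \<open>n = 0\<close>, where \<open>p\<close> is zero.\<close>

lemma opuc_orthogonal_lower:
  assumes "\<And>i. n \<le> i \<Longrightarrow> coeff p i = 0"
  shows "ip (\<phi> n) p = 0"
proof -
  have "ip (\<phi> n) p = 0" if "m \<le> n" "\<And>i. m \<le> i \<Longrightarrow> coeff p i = 0" for m p
    using that
  proof (induction m arbitrary: p)
    case 0
    then have "p = 0" by (intro poly_eqI) auto
    then show ?case by simp
  next
    case (Suc m)
    let ?r = "p - smult (coeff p m) (\<phi> m)"
    have "coeff ?r i = 0" if "m \<le> i" for i
      using Suc.prems(2)[of i] that by (cases "i = m") (auto simp: coeff_opuc_gt)
    moreover have "m \<le> n" using Suc.prems(1) by simp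
    ultimately have "ip (\<phi> n) ?r = 0" by (intro Suc.IH)
    then show ?case
      using Suc.prems(1) opuc_orthogonal[of m n] by (simp add: ip_diff_right ip_smult_right)
  qed
  then show ?thesis using assms by blast
qed

lemma ip_opuc_monom_lt: "j < n \<Longrightarrow> ip (\<phi> n) (monom 1 j) = 0"
  by (rule opuc_orthogonal_lower) simp

lemma ip_opuc_self: "ip (\<phi> n) (\<phi> n) = \<sigma> n"
  unfolding poly_inner_def opuc_norm2_def complex_norm_square[symmetric] of_real_power[symmetric]
  by (rule integral_complex_of_real)

lemma ip_opuc_monom_self: "ip (\<phi> n) (monom 1 n) = \<sigma> n"
proof -
  have "ip (\<phi> n) (\<phi> n - monom 1 n) = 0"
    by (rule opuc_orthogonal_lower) (auto simp: coeff_opuc_gt le_less)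
  then show ?thesis by (simp add: ip_diff_right ip_opuc_self)
qed

lemma opuc_norm2_nonzero: "\<sigma> n \<noteq> 0"
  using ip_opuc_self_nonzero[of n] by (simp add: ip_opuc_self)

section \<open>Reversed polynomials and the Szego recursion\<close>

lemma poly_opuc_star_circle:
  assumes "cmod \<zeta> = 1"
  shows "poly (\<phi>s n) \<zeta> = \<zeta> ^ n * cnj (poly (\<phi> n) \<zeta>)"
proof -
  have "\<zeta> * cnj \<zeta> = 1" "\<zeta> \<noteq> 0"
    using assms by (auto simp: complex_norm_square[symmetric])
  then have "1 / cnj \<zeta> = \<zeta>" by (simp add: field_simps)
  then show ?thesis using poly_opuc_star[of \<zeta> \<mu> n] \<open>\<zeta> \<noteq> 0\<close> by simp
qed

lemma poly_opuc_star_0: "poly (\<phi>s n) 0 = 1"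
  using opuc_degree_monic[of \<mu> n]
  by (simp add: poly_0_coeff_0 opuc_star_def coeff_map_poly)

lemma degree_opuc_star_le: "degree (\<phi>s n) \<le> n"
proof -
  have "degree (\<phi>s n) \<le> degree (reflect_poly (\<phi> n))"
    unfolding opuc_star_def by (rule map_poly_degree_leq)
  also have "\<dots> \<le> n"
    using degree_reflect_poly_le[of "\<phi> n"] opuc_degree_monic[of \<mu> n] by simp
  finally show ?thesis .
qed

text \<open>On the circle \<open>\<phi>s n\<close> times the conjugate of \<open>\<zeta> ^ j\<close>
  is \<open>\<zeta> ^ (n - j)\<close> times the conjugate of \<open>\<phi> n\<close>, so
  orthogonality of \<open>\<phi> n\<close> to lower powers is reflected.\<close>

lemma ip_opuc_star_monom:
  assumes "j \<le> n"
  shows "ip (\<phi>s n) (monom 1 j) = (if j = 0 then \<sigma> n else 0)"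
proof -
  have "ip (\<phi>s n) (monom 1 j) = ip (monom 1 (n - j)) (\<phi> n)"
    unfolding poly_inner_def
  proof (rule integral_circle_measure_cong)
    fix \<zeta> :: complex assume \<zeta>: "cmod \<zeta> = 1"
    then have "\<zeta> * cnj \<zeta> = 1" by (simp add: complex_norm_square[symmetric])
    then have "\<zeta> ^ n * cnj \<zeta> ^ j = \<zeta> ^ (n - j)"
      using assms power_add[of \<zeta> "n - j" j] by (simp add: mult.assoc power_mult_distrib[symmetric])
    then show "poly (\<phi>s n) \<zeta> * cnj (poly (monom 1 j) \<zeta>) =
        poly (monom 1 (n - j)) \<zeta> * cnj (poly (\<phi> n) \<zeta>)"
      by (simp add: poly_opuc_star_circle[OF \<zeta>] poly_monom mult_ac)
  qed (auto intro!: borel_measurable_poly_inner_integrand continuous_intros)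
  also have "\<dots> = (if j = 0 then \<sigma> n else 0)"
    using assms ip_opuc_monom_lt[of "n - j" n] ip_opuc_monom_self[of n]
    by (subst ip_commute) auto
  finally show ?thesis .
qed

text \<open>The difference \<open>p\<close> of the two sides has degree at most \<open>n\<close> and
  no constant term, and it is orthogonal to the powers \<open>1\<close> to \<open>n\<close> of the
  variable; hence it is orthogonal to itself.\<close>

lemma opuc_Suc: "\<phi> (Suc n) = pCons 0 (\<phi> n) + smult (\<alpha> (Suc n)) (\<phi>s n)"
proof -
  define p where "p = \<phi> (Suc n) - pCons 0 (\<phi> n) - smult (\<alpha> (Suc n)) (\<phi>s n)"
  have hi: "coeff p i = 0" if "n < i" for i
    using that degree_opuc_star_le[of n]
    by (cases i; cases "i = Suc n") (auto simp: p_def coeff_opuc_gt coeff_eq_0)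
  have "coeff p 0 = 0"
    using poly_opuc_star_0[of n] by (simp add: p_def verblunsky_def poly_0_coeff_0)
  moreover have "ip p (monom 1 (Suc j)) = 0" if "Suc j \<le> n" for j
    using that ip_opuc_monom_lt[of "Suc j" "Suc n"] ip_opuc_monom_lt[of j n] ip_opuc_star_monom[of "Suc j" n]
    by (simp add: p_def ip_diff_left ip_smult_left ip_pCons_monom)
  \<comment> \<open>The coefficient vanishes for \<open>j = 0\<close> and for \<open>j > n\<close>,
    the inner product for the indices between.\<close>
  ultimately have "cnj (coeff p j) * ip p (monom 1 j) = 0" for j
    using hi[of j] by (cases j; cases "j \<le> n") auto
  moreover have "p = (\<Sum>j\<le>degree p. smult (coeff p j) (monom 1 j))"
    by (simp add: smult_monom poly_as_sum_of_monoms)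
  then have "ip p p = ip p (\<Sum>j\<le>degree p. smult (coeff p j) (monom 1 j))"
    by (rule arg_cong)
  then have "ip p p = (\<Sum>j\<le>degree p. cnj (coeff p j) * ip p (monom 1 j))"
    by (simp only: ip_sum_right ip_smult_right)
  ultimately have "p = 0"
    by (intro ip_self_eq_0_imp) (auto intro!: sum.neutral)
  then show ?thesis by (simp add: p_def algebra_simps)
qed

lemma opuc_star_Suc: "\<phi>s (Suc n) = \<phi>s n + smult (cnj (\<alpha> (Suc n))) (pCons 0 (\<phi> n))"
proof -
  have "poly (\<phi>s (Suc n)) z = poly (\<phi>s n + smult (cnj (\<alpha> (Suc n))) (pCons 0 (\<phi> n))) z" for z
  proof (cases "z = 0")
    case False
    then show ?thesis
      by (simp add: poly_opuc_star opuc_Suc field_simps)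
  qed (simp add: poly_opuc_star_0)
  then show ?thesis by (simp add: poly_eq_poly_eq_iff[symmetric] fun_eq_iff)
qed

lemma ip_pCons_opuc: "ip (pCons 0 (\<phi> n)) 1 = - \<alpha> (Suc n) * \<sigma> n"
proof -
  have "ip (\<phi> (Suc n)) 1 = 0"
    using ip_opuc_monom_lt[of 0 "Suc n"] by simp
  then show ?thesis
    using ip_opuc_star_monom[of 0 n] by (simp add: opuc_Suc ip_add_left ip_smult_left add_eq_0_iff2)
qed

text \<open>Pair the recursion for the reversed polynomials with \<open>1\<close>, using that
  \<open>ip (\<phi>s n) 1\<close> is \<open>\<sigma> n\<close> for every \<open>n\<close>.\<close>

lemma opuc_norm2_Suc: "complex_of_real (\<sigma> (Suc n)) = \<sigma> n - cnj (\<alpha> (Suc n)) * \<alpha> (Suc n) * \<sigma> n"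
  using ip_opuc_star_monom[of 0 "Suc n"] ip_opuc_star_monom[of 0 n] ip_pCons_opuc[of n]
  by (simp add: opuc_star_Suc ip_add_left ip_smult_left flip: smult_pCons)
    (simp add: ip_smult_left mult.assoc del: smult_pCons)

lemma contour_integral_moment:
  "contour_integral (circlepath 0 1) (\<lambda>\<zeta>. poly p \<zeta> * w \<zeta> / \<zeta> ^ Suc j) = \<i> * ip p (monom 1 j)"
  unfolding poly_inner_def
proof (rule contour_integral_circle_measure)
  fix \<zeta> :: complex assume "cmod \<zeta> = 1"
  then have "\<zeta> * cnj \<zeta> = 1" "\<zeta> \<noteq> 0" by (auto simp: complex_norm_square[symmetric])
  then have "cnj (\<zeta> ^ j) = 1 / \<zeta> ^ j"
    by (simp add: nonzero_eq_divide_eq power_mult_distrib[symmetric] mult.commute)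
  then show "poly p \<zeta> * w \<zeta> / \<zeta> ^ Suc j = poly p \<zeta> * cnj (poly (monom 1 j) \<zeta>) * w \<zeta> / \<zeta>"
    by (simp add: poly_monom mult_ac)
qed (auto intro!: borel_measurable_poly_inner_integrand continuous_intros)

section \<open>The functions of the second kind as Cauchy transforms\<close>

text \<open>Dividing by \<open>\<zeta> ^ n\<close> makes conjugates holomorphic off
  \<open>0\<close>: for \<open>p = \<phi>s n\<close> this equals
  \<open>cnj (poly (\<phi> n) \<zeta>) * w \<zeta>\<close> on the circle.\<close>

definition laurent_weight :: "complex poly \<Rightarrow> nat \<Rightarrow> complex \<Rightarrow> complex" where
  "laurent_weight p n \<zeta> = poly p \<zeta> * w \<zeta> / \<zeta> ^ n"

abbreviation C :: "complex poly \<Rightarrow> nat \<Rightarrow> complex \<Rightarrow> complex" where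
  "C p n \<equiv> cauchy_transform 1 (laurent_weight p n)"

lemma laurent_weight_holomorphic: "laurent_weight p n holomorphic_on (UNIV - {0})"
  unfolding laurent_weight_def by (intro holomorphic_intros) auto

lemma laurent_weight_continuous: "continuous_on (sphere 0 1) (laurent_weight p n)"
  by (rule continuous_on_subset[OF holomorphic_on_imp_continuous_on[OF laurent_weight_holomorphic]]) auto

lemma contour_integral_laurent_weight:
  "contour_integral (circlepath 0 1) (laurent_weight p (Suc j)) = \<i> * ip p (monom 1 j)"
  unfolding laurent_weight_def by (rule contour_integral_moment)

lemma C_at_0: "C p n 0 = \<i> * ip p (monom 1 n)"
  unfolding contour_integral_laurent_weight[symmetric]
  by (simp add: cauchy_transform_def laurent_weight_def[abs_def] mult_ac)

lemma power_mult_C: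
  fixes z :: complex
  assumes "cmod z \<noteq> 1"
  shows "z ^ n * C p n z = C p 0 z - (\<Sum>j<n. z ^ j * (\<i> * ip p (monom 1 j)))"
proof -
  have "C p n = cauchy_transform 1 (\<lambda>\<zeta>. laurent_weight p 0 \<zeta> / \<zeta> ^ n)"
    "laurent_weight p (Suc j) = (\<lambda>\<zeta>. laurent_weight p 0 \<zeta> / \<zeta> ^ Suc j)" for j
    unfolding laurent_weight_def by simp_all
  then show ?thesis
    using cauchy_transform_power_shift[OF zero_less_one laurent_weight_continuous assms, of n p 0]
    by (simp add: contour_integral_laurent_weight[symmetric])
qed

text \<open>All moments of order below \<open>n\<close> vanish, so \<open>C (\<phi> n) n\<close>
  decays like \<open>z\<close> to the power \<open>-n-1\<close>.\<close>

lemma power_mult_C_opuc: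
  fixes z :: complex
  assumes "cmod z \<noteq> 1"
  shows "z ^ n * C (\<phi> n) n z = C (\<phi> n) 0 z"
  using power_mult_C[OF assms, of n "\<phi> n"] by (simp add: ip_opuc_monom_lt)

text \<open>Only the moment of order \<open>0\<close> survives; it costs one order of decay compared
  with \<open>\<phi> n\<close>.\<close>

lemma power_mult_C_opuc_star:
  fixes z :: complex
  assumes "cmod z \<noteq> 1" "1 \<le> n"
  shows "z ^ n * C (\<phi>s n) n z = C (\<phi>s n) 0 z - \<i> * \<sigma> n"
proof -
  have "(\<Sum>j<n. z ^ j * (\<i> * ip (\<phi>s n) (monom 1 j))) = (\<Sum>j<n. if j = 0 then \<i> * \<sigma> n else 0)"
    by (intro sum.cong) (auto simp: ip_opuc_star_monom)
  then show ?thesis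
    using power_mult_C[OF assms(1), of n "\<phi>s n"] assms(2) by simp
qed

text \<open>Divided by \<open>\<zeta>\<close>, the kernel is
  \<open>2 / (\<zeta> - z) - 1 / \<zeta>\<close>, a Cauchy kernel plus a moment. Prescribing
  \<open>g\<close> on the circle alone covers both \<open>\<phi> n\<close> and its
  conjugate.\<close>

lemma integral_schwarz_kernel:
  fixes g :: "complex \<Rightarrow> complex"
  assumes "cmod z \<noteq> 1" "g \<in> borel_measurable borel"
    and g: "\<And>\<zeta>. cmod \<zeta> = 1 \<Longrightarrow> g \<zeta> = poly p \<zeta> / \<zeta> ^ n"
  shows "integrable \<mu> (\<lambda>\<zeta>. (\<zeta> + z) / (\<zeta> - z) * g \<zeta>)"
    and "(\<integral>\<zeta>. (\<zeta> + z) / (\<zeta> - z) * g \<zeta> \<partial>\<mu>) = - 2 * \<i> * C p n z - ip p (monom 1 n)"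
proof -
  have m: "(\<lambda>\<zeta>. (\<zeta> + z) / (\<zeta> - z) * g \<zeta>) \<in> borel_measurable borel"
    using assms(2) by measurable
  have "continuous_on (sphere 0 1) (\<lambda>\<zeta>. poly p \<zeta> / \<zeta> ^ n)"
    by (intro continuous_intros) auto
  then have "continuous_on (sphere 0 1) g"
    by (rule continuous_on_eq) (simp add: g)
  then have c: "continuous_on (sphere 0 1) (\<lambda>\<zeta>. (\<zeta> + z) / (\<zeta> - z) * g \<zeta>)"
    using assms(1) by (intro continuous_intros) auto
  show "integrable \<mu> (\<lambda>\<zeta>. (\<zeta> + z) / (\<zeta> - z) * g \<zeta>)"
    by (rule integral_circle_measure[OF m c])
  have "\<i> * (\<integral>\<zeta>. (\<zeta> + z) / (\<zeta> - z) * g \<zeta> \<partial>\<mu>) =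
      contour_integral (circlepath 0 1)
        (\<lambda>\<zeta>. 2 * (laurent_weight p n \<zeta> / (\<zeta> - z)) - laurent_weight p (Suc n) \<zeta>)"
  proof (rule contour_integral_circle_measure[OF m c, symmetric])
    fix \<zeta> :: complex assume \<zeta>: "cmod \<zeta> = 1"
    then have "\<zeta> \<noteq> z" "\<zeta> \<noteq> 0" using assms(1) by auto
    then have k: "(\<zeta> + z) / (\<zeta> - z) / \<zeta> = 2 / (\<zeta> - z) - 1 / \<zeta>"
      by (simp add: field_simps)
    have lw: "laurent_weight p (Suc n) \<zeta> = laurent_weight p n \<zeta> / \<zeta>"
      by (simp add: laurent_weight_def mult_ac)
    have "(\<zeta> + z) / (\<zeta> - z) * g \<zeta> * w \<zeta> / \<zeta> = (\<zeta> + z) / (\<zeta> - z) / \<zeta> * laurent_weight p n \<zeta>"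
      by (simp add: laurent_weight_def g[OF \<zeta>] mult_ac)
    also have "\<dots> = 2 * (laurent_weight p n \<zeta> / (\<zeta> - z)) - laurent_weight p (Suc n) \<zeta>"
      unfolding k lw by (simp add: left_diff_distrib)
    finally show "2 * (laurent_weight p n \<zeta> / (\<zeta> - z)) - laurent_weight p (Suc n) \<zeta> =
        (\<zeta> + z) / (\<zeta> - z) * g \<zeta> * w \<zeta> / \<zeta>" ..
  qed
  also have "\<dots> = 2 * C p n z - \<i> * ip p (monom 1 n)"
    unfolding contour_integral_laurent_weight[symmetric] cauchy_transform_def
    using cauchy_kernel_integrable[OF zero_less_one laurent_weight_continuous assms(1)]
      circlepath_integrable[OF zero_less_one laurent_weight_continuous]
    by (simp only: contour_integral_diff contour_integral_lmul contour_integrable_lmul)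
  finally have e: "\<i> * (\<integral>\<zeta>. (\<zeta> + z) / (\<zeta> - z) * g \<zeta> \<partial>\<mu>) = 2 * C p n z - \<i> * ip p (monom 1 n)" .
  have "x = - 2 * \<i> * c - d" if "\<i> * x = 2 * c - \<i> * d" for x c d :: complex
    using that by (auto simp: complex_eq_iff)
  from this[OF e]
  show "(\<integral>\<zeta>. (\<zeta> + z) / (\<zeta> - z) * g \<zeta> \<partial>\<mu>) = - 2 * \<i> * C p n z - ip p (monom 1 n)" .
qed

text \<open>The Caratheodory terms cancel, leaving the kernel integral of \<open>\<phi> n\<close>.
  Its constant is the moment of order \<open>0\<close>, which vanishes for
  \<open>n \<ge> 1\<close>.\<close>

lemma eps_eq_C:
  fixes z :: complex
  assumes "cmod z \<noteq> 1" "1 \<le> n"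
  shows "eps \<mu> n z = - 2 * \<i> * z ^ n * C (\<phi> n) n z"
proof -
  define K where "K \<zeta> = (\<zeta> + z) / (\<zeta> - z)" for \<zeta>
  have i1: "integrable \<mu> (\<lambda>\<zeta>. K \<zeta> * poly (\<phi> n) \<zeta>)"
    and e1: "(\<integral>\<zeta>. K \<zeta> * poly (\<phi> n) \<zeta> \<partial>\<mu>) = - 2 * \<i> * C (\<phi> n) 0 z - ip (\<phi> n) (monom 1 0)"
    using integral_schwarz_kernel[OF assms(1) borel_measurable_poly, of "\<phi> n" "\<phi> n" 0] by (simp_all add: K_def)
  have i2: "integrable \<mu> K"
    using integral_schwarz_kernel(1)[OF assms(1), of "\<lambda>_. 1" 1 0] by (simp add: K_def[abs_def])
  have "assoc_poly \<mu> n z = (\<integral>\<zeta>. K \<zeta> * poly (\<phi> n) \<zeta> \<partial>\<mu>) - caratheodory \<mu> z * poly (\<phi> n) z"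
    unfolding assoc_poly_def caratheodory_def K_def[symmetric] right_diff_distrib
    using i1 i2 by simp
  then show ?thesis
    using e1 assms ip_opuc_monom_lt[of 0 n] power_mult_C_opuc[OF assms(1), of n]
    by (simp add: eps_def mult.assoc)
qed

lemma eps_star_eq_C:
  fixes z :: complex
  assumes "cmod z \<noteq> 1" "1 \<le> n"
  shows "eps_star \<mu> n z = 2 * \<i> * z ^ n * C (\<phi>s n) n z"
proof -
  define K where "K \<zeta> = (\<zeta> + z) / (\<zeta> - z)" for \<zeta>
  have g: "cnj (poly (\<phi> n) \<zeta>) = poly (\<phi>s n) \<zeta> / \<zeta> ^ n" if "cmod \<zeta> = 1" for \<zeta>
    using that by (auto simp: poly_opuc_star_circle)
  have m: "(\<lambda>\<zeta>. cnj (poly (\<phi> n) \<zeta>)) \<in> borel_measurable borel"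
    by measurable
  note k = integral_schwarz_kernel[OF assms(1) m g, folded K_def]
  have i2: "integrable \<mu> K"
    using integral_schwarz_kernel(1)[OF assms(1), of "\<lambda>_. 1" 1 0] by (simp add: K_def[abs_def])
  have "assoc_poly_star \<mu> n z =
      - (\<integral>\<zeta>. z ^ n * (K \<zeta> * cnj (poly (\<phi> n) \<zeta>)) - K \<zeta> * poly (\<phi>s n) z \<partial>\<mu>)"
    unfolding assoc_poly_star_def K_def[symmetric] right_diff_distrib by (simp only: mult_ac)
  also have "\<dots> = - (z ^ n * (\<integral>\<zeta>. K \<zeta> * cnj (poly (\<phi> n) \<zeta>) \<partial>\<mu>) -
      caratheodory \<mu> z * poly (\<phi>s n) z)"
    unfolding caratheodory_def K_def[symmetric] using k(1) i2 by simp
  finally show ?thesis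
    using k(2) assms ip_opuc_star_monom[of n n] by (simp add: eps_star_def mult_ac)
qed

text \<open>With index \<open>0\<close> the density depends linearly on the polynomial and no longer
  on \<open>n\<close>, so the polynomial recursions carry over.\<close>

lemma eps_eq_C0:
  fixes z :: complex
  assumes "cmod z \<noteq> 1" "1 \<le> n"
  shows "eps \<mu> n z = - 2 * \<i> * C (\<phi> n) 0 z"
  unfolding eps_eq_C[OF assms] mult.assoc power_mult_C_opuc[OF assms(1)] ..

lemma eps_star_eq_C0:
  fixes z :: complex
  assumes "cmod z \<noteq> 1" "1 \<le> n"
  shows "eps_star \<mu> n z = 2 * \<i> * (C (\<phi>s n) 0 z - \<i> * \<sigma> n)"
  unfolding eps_star_eq_C[OF assms] mult.assoc power_mult_C_opuc_star[OF assms] ..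

section \<open>Recursions for the functions of the second kind\<close>

lemma C_pCons_opuc:
  fixes z :: complex
  assumes "cmod z \<noteq> 1"
  shows "C (pCons 0 (\<phi> n)) 0 z = z * C (\<phi> n) 0 z - \<i> * \<alpha> (Suc n) * \<sigma> n"
proof -
  have "contour_integral (circlepath 0 1) (laurent_weight (\<phi> n) 0) =
      contour_integral (circlepath 0 1) (laurent_weight (pCons 0 (\<phi> n)) (Suc 0))"
    by (rule contour_integral_cong) (auto simp: laurent_weight_def)
  also have "\<dots> = - \<i> * \<alpha> (Suc n) * \<sigma> n"
    using ip_pCons_opuc[of n] by (simp add: contour_integral_laurent_weight)
  finally show ?thesis
    using cauchy_transform_mult_var[OF zero_less_one laurent_weight_continuous assms, of "\<phi> n" 0]
    by (simp add: laurent_weight_def[abs_def] mult_ac)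
qed

lemma C_add_smult:
  fixes z :: complex
  assumes "cmod z \<noteq> 1"
  shows "C (p + smult c r) n z = C p n z + c * C r n z"
proof -
  have "laurent_weight (p + smult c r) n = (\<lambda>\<zeta>. laurent_weight p n \<zeta> + c * laurent_weight r n \<zeta>)"
    by (simp add: laurent_weight_def fun_eq_iff algebra_simps add_divide_distrib)
  then show ?thesis
    using assms laurent_weight_continuous
    by (simp add: cauchy_transform_add cauchy_transform_cmult continuous_on_mult_left)
qed

text \<open>The constant left over by multiplication by \<open>\<zeta>\<close> is exactly the one in
  \<open>eps_star_eq_C0\<close>.\<close>

lemma eps_Suc:
  fixes z :: complex
  assumes "cmod z \<noteq> 1" "1 \<le> n"
  shows "eps \<mu> (Suc n) z = z * eps \<mu> n z - \<alpha> (Suc n) * eps_star \<mu> n z"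
  using assms
  by (simp add: eps_eq_C0 eps_star_eq_C0 opuc_Suc C_add_smult C_pCons_opuc algebra_simps)

text \<open>Here the constants balance through the recursion for \<open>\<sigma>\<close>.\<close>

lemma eps_star_Suc:
  fixes z :: complex
  assumes "cmod z \<noteq> 1" "1 \<le> n"
  shows "eps_star \<mu> (Suc n) z = eps_star \<mu> n z - cnj (\<alpha> (Suc n)) * z * eps \<mu> n z"
proof -
  have "C (\<phi>s (Suc n)) 0 z = C (\<phi>s n) 0 z +
      cnj (\<alpha> (Suc n)) * (z * C (\<phi> n) 0 z - \<i> * \<alpha> (Suc n) * \<sigma> n)"
    unfolding opuc_star_Suc C_add_smult[OF assms(1)] C_pCons_opuc[OF assms(1)] ..
  then show ?thesis
    using assms by (simp add: eps_eq_C0 eps_star_eq_C0 opuc_norm2_Suc algebra_simps)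
qed

section \<open>Polynomials built from the transforms\<close>

lemma C_opuc_bigo: "(\<lambda>z. z ^ Suc n * C (\<phi> n) n z) \<in> O[at_infinity](\<lambda>z. z ^ 0)"
proof -
  have "(\<lambda>z. z * C (\<phi> n) 0 z) \<in> O[at_infinity](\<lambda>z. z * inverse z)"
    by (intro landau_o.big.mult_left cauchy_transform_bigo laurent_weight_continuous) simp
  also have "(\<lambda>z. z * inverse z) \<in> O[at_infinity](\<lambda>z::complex. z ^ 0)"
    by (rule bigoI[of _ 1]) (auto simp: eventually_at_infinity field_simps intro!: exI[of _ 1])
  finally have "(\<lambda>z. z * C (\<phi> n) 0 z) \<in> O[at_infinity](\<lambda>z::complex. z ^ 0)" .
  moreover have "\<forall>\<^sub>F z in at_infinity. z ^ Suc n * C (\<phi> n) n z = z * C (\<phi> n) 0 z"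
    unfolding eventually_at_infinity
    by (intro exI[of _ 2]) (auto simp flip: power_mult_C_opuc)
  ultimately show ?thesis by (subst landau_o.big.in_cong)
qed

lemma C_opuc_star_bigo:
  assumes "1 \<le> n"
  shows "(\<lambda>z. z ^ Suc n * C (\<phi>s n) n z) \<in> O[at_infinity](\<lambda>z. z ^ 1)"
proof -
  have "C (\<phi>s n) 0 \<in> O[at_infinity](\<lambda>z. inverse z)"
    by (intro cauchy_transform_bigo laurent_weight_continuous) simp
  also have "(\<lambda>z. inverse z) \<in> O[at_infinity](\<lambda>z::complex. 1)"
    by (rule bigoI[of _ 1])
      (auto simp: eventually_at_infinity norm_inverse inverse_le_1_iff intro!: exI[of _ 1])
  finally have "(\<lambda>z. z * (C (\<phi>s n) 0 z - \<i> * \<sigma> n)) \<in> O[at_infinity](\<lambda>z. z * 1)"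
    by (intro landau_o.big.mult_left sum_in_bigo) auto
  moreover have "\<forall>\<^sub>F z in at_infinity. z ^ Suc n * C (\<phi>s n) n z = z * (C (\<phi>s n) 0 z - \<i> * \<sigma> n)"
    unfolding eventually_at_infinity using assms
    by (intro exI[of _ 2]) (auto simp flip: power_mult_C_opuc_star)
  ultimately show ?thesis by (subst landau_o.big.in_cong) simp_all
qed

text \<open>The common source of the matrix entries and the determinant. The exponent
  \<open>k\<close> is \<open>0\<close> if both polynomials are \<open>\<phi> n\<close> and
  \<open>1\<close> as soon as \<open>\<phi>s n\<close> is involved.\<close>

lemma C_combination_poly:
  fixes q :: real and V W p\<^sub>1 p\<^sub>2 :: "complex poly"
  assumes q: "0 < q" "q \<le> 1"
    and func: "\<And>z::complex. z \<noteq> 0 \<Longrightarrow> poly W z * w (q * z) = poly V z * w z"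
    and deg: "degree V \<le> D" "degree W \<le> D" "degree p\<^sub>1 \<le> n" "degree p\<^sub>2 \<le> n"
    and growth: "(\<lambda>z. z ^ Suc n * C p\<^sub>1 n z) \<in> O[at_infinity](\<lambda>z. z ^ k)"
      "(\<lambda>z. z ^ Suc n * C p\<^sub>2 n z) \<in> O[at_infinity](\<lambda>z. z ^ k)"
  shows "\<exists>P. (P = 0 \<or> degree P < D + k) \<and>
    (\<forall>z::complex. cmod z < 1 \<or> 1 / q < cmod z \<longrightarrow>
       poly P z = poly W z * poly p\<^sub>2 z * (q ^ n * C p\<^sub>1 n (q * z)) -
                  poly V z * poly p\<^sub>1 (q * z) * C p\<^sub>2 n z)"
proof -
  \<comment> \<open>The factor \<open>q ^ n\<close> undoes the power in the denominator of
    \<open>laurent_weight\<close> at \<open>q * z\<close>, so that the jump condition is the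
    functional equation of \<open>w\<close>.\<close>
  let ?a = "\<lambda>z::complex. poly W z * poly p\<^sub>2 z * q ^ n"
  let ?b = "\<lambda>z::complex. poly V z * poly p\<^sub>1 (q * z)"
  have bq: "(\<lambda>z::complex. (q * z) ^ j) \<in> O[at_infinity](\<lambda>z. z ^ j)" for j
    by (simp add: power_mult_distrib)
  have nz: "\<forall>\<^sub>F z::complex in at_infinity. z ^ n \<noteq> 0"
    unfolding eventually_at_infinity by (intro exI[of _ 1]) auto
  have lim: "filterlim (\<lambda>z::complex. of_real q * z) at_infinity at_infinity"
    using q by (intro tendsto_mult_filterlim_at_infinity[of _ "of_real q"] filterlim_ident) auto
  have p1: "(\<lambda>z::complex. poly p\<^sub>1 (q * z)) \<in> O[at_infinity](\<lambda>z. z ^ n)"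
    using landau_o.big.compose[OF poly_bigo_at_infinity[OF deg(3)] lim] bq
    by (rule landau_o.big_trans)
  have g1: "(\<lambda>z::complex. (q * z) ^ Suc n * C p\<^sub>1 n (q * z)) \<in> O[at_infinity](\<lambda>z. z ^ k)"
    using landau_o.big.compose[OF growth(1) lim] bq by (rule landau_o.big_trans)
  have "(\<lambda>z::complex. (poly W z * poly p\<^sub>2 z) * ((q * z) ^ Suc n * C p\<^sub>1 n (q * z)))
      \<in> O[at_infinity](\<lambda>z. (z ^ D * z ^ n) * z ^ k)"
    using deg by (intro landau_o.big.mult poly_bigo_at_infinity g1)
  also have "(\<lambda>z::complex. (poly W z * poly p\<^sub>2 z) * ((q * z) ^ Suc n * C p\<^sub>1 n (q * z))) =
      (\<lambda>z::complex. of_real q * (z ^ n * (z * (?a z * C p\<^sub>1 n (q * z)))))"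
    by (simp add: fun_eq_iff power_mult_distrib mult_ac)
  finally have t1: "(\<lambda>z::complex. z ^ n * (z * (?a z * C p\<^sub>1 n (q * z))))
      \<in> O[at_infinity](\<lambda>z. (z ^ D * z ^ n) * z ^ k)"
    using q by (subst (asm) landau_o.big.cmult_in_iff) auto
  have "(\<lambda>z::complex. (poly V z * poly p\<^sub>1 (q * z)) * (z ^ Suc n * C p\<^sub>2 n z))
      \<in> O[at_infinity](\<lambda>z. (z ^ D * z ^ n) * z ^ k)"
    using deg by (intro landau_o.big.mult poly_bigo_at_infinity growth(2) p1)
  also have "(\<lambda>z::complex. (poly V z * poly p\<^sub>1 (q * z)) * (z ^ Suc n * C p\<^sub>2 n z)) =
      (\<lambda>z::complex. z ^ n * (z * (?b z * C p\<^sub>2 n z)))"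
    by (simp add: fun_eq_iff mult_ac)
  finally have t2: "(\<lambda>z::complex. z ^ n * (z * (?b z * C p\<^sub>2 n z)))
      \<in> O[at_infinity](\<lambda>z. (z ^ D * z ^ n) * z ^ k)" .
  note sum_in_bigo(2)[OF t1 t2]
  then have "(\<lambda>z::complex. z ^ n * (z * (?a z * C p\<^sub>1 n (q * z) - ?b z * C p\<^sub>2 n z)))
      \<in> O[at_infinity](\<lambda>z. z ^ n * z ^ (D + k))"
    by (simp add: algebra_simps power_add)
  \<comment> \<open>The factor \<open>z ^ n\<close> coming from the growth of the polynomials
    cancels against the decay of the transforms.\<close>
  then have "(\<lambda>z::complex. z * (?a z * C p\<^sub>1 n (q * z) - ?b z * C p\<^sub>2 n z)) \<in> O[at_infinity](\<lambda>z. z ^ (D + k))"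
    by (rule iffD1[OF landau_o.big.mult_cancel_left[OF bigtheta_refl nz]])
  moreover have "?a z * laurent_weight p\<^sub>1 n (q * z) = ?b z * laurent_weight p\<^sub>2 n z"
    if "z \<noteq> 0" for z :: complex
    using q func[OF that] by (simp add: laurent_weight_def power_mult_distrib field_simps)
  moreover have "?a holomorphic_on UNIV" "?b holomorphic_on UNIV"
    by (intro holomorphic_intros)+
  ultimately obtain P where "P = 0 \<or> degree P < D + k"
    "\<forall>z::complex. cmod z < 1 \<or> 1 / q < cmod z \<longrightarrow>
       poly P z = ?a z * C p\<^sub>1 n (q * z) - ?b z * C p\<^sub>2 n z"
    using cauchy_transform_combination_poly[OF q laurent_weight_holomorphic laurent_weight_holomorphic,
        of ?a ?b p\<^sub>1 n p\<^sub>2 n "D + k"]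
    by blast
  then show ?thesis by (intro exI[of _ P]) (auto simp: mult_ac)
qed

text \<open>The case \<open>q = V = W = 1\<close> of the previous lemma gives a constant, which is evaluated at \<open>0\<close>.\<close>

lemma C_determinant:
  fixes z :: complex
  assumes "cmod z \<noteq> 1" "1 \<le> n"
  shows "poly (\<phi>s n) z * C (\<phi> n) n z - poly (\<phi> n) z * C (\<phi>s n) n z = \<i> * \<sigma> n"
proof -
  have big: "(\<lambda>z. z ^ Suc n * C (\<phi> n) n z) \<in> O[at_infinity](\<lambda>z. z ^ 1)"
    using C_opuc_bigo
    by (rule landau_o.big_trans, intro bigoI[of _ 1])
      (auto simp: eventually_at_infinity intro!: exI[of _ 1])
  have "degree (\<phi> n) \<le> n" using opuc_degree_monic[of \<mu> n] by simp
  then obtain P where P: "P = 0 \<or> degree P < 0 + 1"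
    "\<And>z. cmod z < 1 \<or> 1 < cmod z \<Longrightarrow>
       poly P z = poly (\<phi>s n) z * C (\<phi> n) n z - poly (\<phi> n) z * C (\<phi>s n) n z"
    using C_combination_poly[of 1 1 1 0 "\<phi> n" n "\<phi>s n" 1]
      degree_opuc_star_le[of n] big C_opuc_star_bigo[OF assms(2)] by auto
  \<comment> \<open>Degree below 1 means constant. At \<open>0\<close> the second product drops out,
    since \<open>\<phi>s n\<close> is orthogonal to the power \<open>n\<close>.\<close>
  have "poly P z = poly P 0"
    using P(1) by (auto elim!: degree_eq_zeroE)
  also have "poly P 0 = \<i> * \<sigma> n"
    using P(2)[of 0] assms(2) ip_opuc_star_monom[of n n]
    by (simp add: C_at_0 ip_opuc_monom_self poly_opuc_star_0)
  finally show ?thesis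
    using P(2)[of z] assms(1) by (cases "cmod z < 1") auto
qed

section \<open>The matrix \<open>Y_mat\<close>: recursion and determinant\<close>

lemma Y_mat_Suc:
  fixes z :: complex
  assumes "cmod z \<noteq> 1" "1 \<le> n"
  shows "Y_mat \<mu> w (Suc n) z = B_mat \<mu> n z ** Y_mat \<mu> w n z"
  using assms
  by (intro matrix_2_eqI)
    (simp_all add: Y_mat_def B_mat_def matrix_2_simps opuc_Suc opuc_star_Suc eps_Suc eps_star_Suc
      diff_divide_distrib mult_ac)

lemma det_Y_mat:
  fixes z :: complex
  assumes "cmod z \<noteq> 1" "1 \<le> n"
  shows "det (Y_mat \<mu> w n z) = - 2 * \<sigma> n * z ^ n / w z"
proof -
  have "poly (\<phi> n) z * eps_star \<mu> n z + poly (\<phi>s n) z * eps \<mu> n z =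
      2 * \<i> * z ^ n * (poly (\<phi> n) z * C (\<phi>s n) n z - poly (\<phi>s n) z * C (\<phi> n) n z)"
    using assms by (simp add: eps_eq_C eps_star_eq_C algebra_simps)
  also have "poly (\<phi> n) z * C (\<phi>s n) n z - poly (\<phi>s n) z * C (\<phi> n) n z = - (\<i> * \<sigma> n)"
    unfolding C_determinant[OF assms, symmetric] by simp
  finally have "poly (\<phi> n) z * eps_star \<mu> n z + poly (\<phi>s n) z * eps \<mu> n z = 2 * \<sigma> n * z ^ n"
    by simp
  moreover have "det (Y_mat \<mu> w n z) =
      - (poly (\<phi> n) z * eps_star \<mu> n z + poly (\<phi>s n) z * eps \<mu> n z) / w z"
    by (simp add: det_2 Y_mat_def vector_2 add_divide_distrib diff_divide_distrib mult_ac)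
  ultimately show ?thesis by simp
qed

end

section \<open>The q-difference system\<close>

locale q_circle_weight = circle_weight +
  fixes q :: real and V W :: "complex poly"
  assumes q: "0 < q" "q < 1"
    and W_nonzero: "W \<noteq> 0"
    and quotient: "\<And>z::complex. z \<noteq> 0 \<Longrightarrow> poly W z \<noteq> 0 \<Longrightarrow> w (q * z) = poly V z / poly W z * w z"
begin

text \<open>With the denominator cleared, the identity theorem extends the relation across the zeros
  of \<open>W\<close>.\<close>

lemma functional_equation:
  fixes z :: complex
  assumes "z \<noteq> 0"
  shows "poly W z * w (q * z) = poly V z * w z"
proof -
  have "UNIV - {0 :: complex} \<noteq> {}"
    using assms by blast
  note W = poly_nonzero_on_open[OF W_nonzero _ this]
  show ?thesis
  proof (rule analytic_continuation_open[of "{z \<in> UNIV - {0 :: complex}. poly W z \<noteq> 0}" "UNIV - {0}"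
        "\<lambda>z::complex. poly W z * w (q * z)" "\<lambda>z. poly V z * w z"])
    show "open {z \<in> UNIV - {0 :: complex}. poly W z \<noteq> 0}" "{z \<in> UNIV - {0 :: complex}. poly W z \<noteq> 0} \<noteq> {}"
      using W by auto
  qed (use assms q in \<open>auto intro!: holomorphic_intros connected_punctured_plane simp: quotient\<close>)
qed

text \<open>Provides an open set on which the pointwise reading of the system has no vanishing
  denominator.\<close>

lemma regular_points_dense:
  fixes U :: "complex set"
  assumes "open U" "U \<noteq> {}" "0 \<notin> U"
  defines "G \<equiv> {z\<in>U. poly V z \<noteq> 0 \<and> w z \<noteq> 0 \<and> w (of_real q * z) \<noteq> 0}"
  shows "open G" "G \<noteq> {}"
proof -
  have S: "open (UNIV - {0 :: complex})" "connected (UNIV - {0 :: complex})"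
    using connected_punctured_plane by auto
  obtain z0 where z0: "z0 \<noteq> 0" "w z0 \<noteq> 0" using nontrivial by blast
  define z1 where "z1 = z0 / of_real q"
  have z1: "z1 \<noteq> 0" "w (q * z1) \<noteq> 0" using z0 q by (auto simp: z1_def)
  have hq: "(\<lambda>z::complex. w (q * z)) holomorphic_on UNIV - {0}"
    using q by (intro holomorphic_intros) auto
  have "UNIV - {0 :: complex} \<noteq> {}"
    using z0 by blast
  note nW = poly_nonzero_on_open[OF W_nonzero S(1) this]
  \<comment> \<open>For \<open>V = 0\<close> the functional equation would make
    \<open>w (q * z)\<close> vanish wherever \<open>W\<close> does not.\<close>
  have "V \<noteq> 0"
  proof
    assume "V = 0"
    have "{z \<in> {z \<in> UNIV - {0 :: complex}. poly W z \<noteq> 0}. w (of_real q * z) \<noteq> 0} \<noteq> {}"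
      using holomorphic_nonzero_on_open(2)[OF hq S _ z1(2) nW(1) _ nW(2)] z1 by auto
    then obtain z :: complex where "z \<noteq> 0" "poly W z \<noteq> 0" "w (q * z) \<noteq> 0" by auto
    then show False using functional_equation[of z] \<open>V = 0\<close> by simp
  qed
  let ?U1 = "{z\<in>U. poly V z \<noteq> 0}"
  have U1: "open ?U1" "?U1 \<noteq> {}"
    using poly_nonzero_on_open[OF \<open>V \<noteq> 0\<close> assms(1,2)] by blast+
  let ?U2 = "{z\<in>?U1. w z \<noteq> 0}"
  have U2: "open ?U2" "?U2 \<noteq> {}"
    using holomorphic_nonzero_on_open[OF holomorphic S _ z0(2) U1(1) _ U1(2)] z0 assms by blast+
  have "open {z\<in>?U2. w (of_real q * z) \<noteq> 0}" "{z\<in>?U2. w (of_real q * z) \<noteq> 0} \<noteq> {}"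
    using holomorphic_nonzero_on_open[OF hq S _ z1(2) U2(1) _ U2(2)] z1 assms by blast+
  moreover have "G = {z\<in>?U2. w (of_real q * z) \<noteq> 0}"
    by (auto simp: G_def)
  ultimately show "open G" "G \<noteq> {}" by simp_all
qed

lemma same_side_norm:
  fixes z :: complex
  assumes "z \<in> same_side q"
  shows "z \<noteq> 0" "cmod z \<noteq> 1" "cmod (of_real q * z) \<noteq> 1" "cmod z < 1 \<or> 1 / q < cmod z"
proof -
  have "1 < 1 / q" using q by simp
  moreover have "1 / q < cmod z \<longleftrightarrow> 1 < q * cmod z" using q by (simp add: field_simps)
  moreover have "q * cmod z \<le> cmod z" using q by (simp add: mult_left_le_one_le)
  ultimately show "z \<noteq> 0" "cmod z \<noteq> 1" "cmod (of_real q * z) \<noteq> 1" "cmod z < 1 \<or> 1 / q < cmod z"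
    using assms q by (auto simp: same_side_def norm_mult)
qed

text \<open>Solving for the matrix gives \<open>V(z)\<close> times \<open>Y(qz)\<close> times the
  inverse of \<open>Y(z)\<close>. By the determinant formula and the functional equation its entries
  are, up to sign, four combinations of \<open>C_combination_poly\<close> divided by
  \<open>\<i> * \<sigma> n\<close>.\<close>

lemma q_difference_system_exists:
  assumes D: "D = max (degree V) (degree W)" and n: "1 \<le> n" and \<alpha>: "\<alpha> (n + 1) \<noteq> 0"
  shows "\<exists>\<Theta> \<Omega>. is_Theta q V W \<mu> n \<Theta> \<and> (\<Theta> = 0 \<or> degree \<Theta> < D) \<and>
                 is_Omega q V W \<mu> n \<Omega> \<and> degree \<Omega> \<le> D \<and>
                 (\<exists>\<Theta>s \<Omega>s. (\<Theta>s = 0 \<or> degree \<Theta>s < D) \<and> degree \<Omega>s \<le> D \<and>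
                    q_difference_system q V \<mu> w n (A_mat \<mu> n \<Theta> \<Omega> \<Theta>s \<Omega>s))"
proof -
  define a where "a = \<alpha> (Suc n)"
  define s where "s = complex_of_real (\<sigma> n)"
  have nz: "a \<noteq> 0" "s \<noteq> 0"
    using \<alpha> opuc_norm2_nonzero[of n] by (auto simp: a_def s_def)
  let ?M = "\<lambda>p\<^sub>1 p\<^sub>2 (z::complex). poly W z * poly p\<^sub>2 z * (q ^ n * C p\<^sub>1 n (q * z)) -
                  poly V z * poly p\<^sub>1 (q * z) * C p\<^sub>2 n z"
  have C1: "(\<lambda>z. z ^ Suc n * C (\<phi> n) n z) \<in> O[at_infinity](\<lambda>z. z ^ 1)"
    using C_opuc_bigo
    by (rule landau_o.big_trans, intro bigoI[of _ 1])
      (auto simp: eventually_at_infinity intro!: exI[of _ 1])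
  note C2 = C_opuc_star_bigo[OF n]
  have deg: "degree V \<le> D" "degree W \<le> D" "degree (\<phi> n) \<le> n" "degree (\<phi>s n) \<le> n"
    using D opuc_degree_monic[of \<mu> n] degree_opuc_star_le[of n] by auto
  note M = C_combination_poly[OF q(1) less_imp_le[OF q(2)] functional_equation]
  obtain M11 where M11: "M11 = 0 \<or> degree M11 < D"
    "\<And>z::complex. cmod z < 1 \<or> 1 / q < cmod z \<Longrightarrow> poly M11 z = ?M (\<phi> n) (\<phi> n) z"
    using M[OF _ deg(1,2) deg(3) deg(3) C_opuc_bigo C_opuc_bigo] by auto
  obtain M12 where M12: "M12 = 0 \<or> degree M12 < D + 1"
    "\<And>z::complex. cmod z < 1 \<or> 1 / q < cmod z \<Longrightarrow> poly M12 z = ?M (\<phi> n) (\<phi>s n) z"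
    using M[OF _ deg(1,2) deg(3) deg(4) C1 C2] by blast
  obtain M21 where M21: "M21 = 0 \<or> degree M21 < D + 1"
    "\<And>z::complex. cmod z < 1 \<or> 1 / q < cmod z \<Longrightarrow> poly M21 z = ?M (\<phi>s n) (\<phi> n) z"
    using M[OF _ deg(1,2) deg(4) deg(3) C2 C1] by blast
  obtain M22 where M22: "M22 = 0 \<or> degree M22 < D + 1"
    "\<And>z::complex. cmod z < 1 \<or> 1 / q < cmod z \<Longrightarrow> poly M22 z = ?M (\<phi>s n) (\<phi>s n) z"
    using M[OF _ deg(1,2) deg(4) deg(4) C2 C2] by blast
  \<comment> \<open>Both transforms vanish at \<open>0\<close> by orthogonality of
    \<open>\<phi>s n\<close> to the power \<open>n\<close>. This supplies the factor
    \<open>z\<close> in the lower left entry of \<open>A_mat\<close>.\<close>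
  have "poly M22 0 = 0"
    using M22(2)[of 0] n by (simp add: C_at_0 ip_opuc_star_monom)
  then obtain N where N: "M22 = pCons 0 N" by (cases M22) auto
  \<comment> \<open>The four definitions solve the entries of \<open>A_mat\<close> for the unknowns:
    they are \<open>M12\<close>, \<open>- M11\<close>, \<open>M22\<close>, \<open>- M21\<close>,
    each divided by \<open>\<i> * s\<close>.\<close>
  define \<Theta> where "\<Theta> = smult (1 / (\<i> * a * s)) M11"
  define \<Omega> where "\<Omega> = smult (1 / (\<i> * s)) M12 + pCons 0 \<Theta>"
  define \<Theta>s where "\<Theta>s = smult (- 1 / (\<i> * cnj a * s)) N"
  define \<Omega>s where "\<Omega>s = smult (- 1 / (\<i> * s)) M21 + \<Theta>s"
  have d\<Theta>: "\<Theta> = 0 \<or> degree \<Theta> < D"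
    using M11(1) by (auto simp: \<Theta>_def)
  have d\<Theta>s: "\<Theta>s = 0 \<or> degree \<Theta>s < D"
    using M22(1) by (auto simp: \<Theta>s_def N split: if_splits)
  have d\<Omega>: "degree \<Omega> \<le> D"
    unfolding \<Omega>_def using M12(1) d\<Theta> by (intro degree_add_le) auto
  have d\<Omega>s: "degree \<Omega>s \<le> D"
    unfolding \<Omega>s_def using M21(1) d\<Theta>s by (intro degree_add_le) auto
  have scale: "2 * a * s * k * (1 / (\<i> * a * s) * m) = - 2 * \<i> * k * m" for k m
    using nz by (simp add: field_simps)
  have th: "is_Theta q V W \<mu> n \<Theta>"
    unfolding is_Theta_def
  proof
    fix z :: complex assume z: "z \<in> same_side q"
    note side = same_side_norm[OF z]
    have "2 * a * s * z ^ n * poly \<Theta> z = - 2 * \<i> * z ^ n * ?M (\<phi> n) (\<phi> n) z"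
      unfolding \<Theta>_def poly_smult M11(2)[OF side(4)] using scale by (simp only:)
    then show "2 * \<alpha> (n + 1) * of_real (\<sigma> n) * z ^ n * poly \<Theta> z =
        poly W z * eps \<mu> n (of_real q * z) * poly (\<phi> n) z -
        poly V z * eps \<mu> n z * poly (\<phi> n) (of_real q * z)"
      unfolding eps_eq_C[OF side(2) n] eps_eq_C[OF side(3) n]
      by (simp add: a_def s_def power_mult_distrib algebra_simps)
  qed
  have "is_Omega q V W \<mu> n \<Omega>"
    unfolding is_Omega_def
  proof
    fix z :: complex assume z: "z \<in> same_side q"
    note side = same_side_norm[OF z]
    \<comment> \<open>The recursions split the expression for \<open>\<Omega>\<close> into
      \<open>z\<close> times that for \<open>\<Theta>\<close> and \<open>a\<close> times a mixed one
      given by \<open>M12\<close>.\<close>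
    have "2 * a * s * z ^ n * poly \<Omega> z =
        - 2 * \<i> * z ^ n * a * ?M (\<phi> n) (\<phi>s n) z + z * (2 * a * s * z ^ n * poly \<Theta> z)"
      unfolding \<Omega>_def poly_add poly_smult poly_pCons M12(2)[OF side(4)] distrib_left
      using scale[of "z ^ n * a"] nz by (simp add: mult_ac)
    also have "2 * a * s * z ^ n * poly \<Theta> z =
        poly W z * eps \<mu> n (of_real q * z) * poly (\<phi> n) z -
        poly V z * eps \<mu> n z * poly (\<phi> n) (of_real q * z)"
      using th z by (simp add: is_Theta_def a_def s_def)
    finally show "2 * \<alpha> (n + 1) * of_real (\<sigma> n) * z ^ n * poly \<Omega> z =
        poly W z * eps \<mu> n (of_real q * z) * poly (\<phi> (n + 1)) z -
        poly V z * eps \<mu> (n + 1) z * poly (\<phi> n) (of_real q * z)"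
      unfolding Suc_eq_plus1[symmetric] eps_Suc[OF side(2) n] opuc_Suc
        eps_eq_C[OF side(2) n] eps_eq_C[OF side(3) n] eps_star_eq_C[OF side(2) n]
      by (simp add: a_def s_def power_mult_distrib algebra_simps)
  qed
  moreover have "q_difference_system q V \<mu> w n (A_mat \<mu> n \<Theta> \<Omega> \<Theta>s \<Omega>s)"
    unfolding q_difference_system_def
  proof (intro ballI impI)
    fix z :: complex assume z: "z \<in> same_side q" "poly V z \<noteq> 0" "w z \<noteq> 0" "w (of_real q * z) \<noteq> 0"
    note side = same_side_norm[OF z(1)]
    define c where "c = 1 / (\<i> * s)"
    define f f' g g' where "f = poly (\<phi> n) z" and "f' = poly (\<phi> n) (q * z)"
      and "g = poly (\<phi>s n) z" and "g' = poly (\<phi>s n) (q * z)"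
    define S T S' T' where "S = C (\<phi> n) n z" and "T = C (\<phi>s n) n z"
      and "S' = q ^ n * C (\<phi> n) n (q * z)" and "T' = q ^ n * C (\<phi>s n) n (q * z)"
    define v u wz wq where "v = poly V z" and "u = poly W z" and "wz = w z" and "wq = w (q * z)"
    note defs = f_def f'_def g_def g'_def S_def T_def S'_def T'_def v_def u_def wz_def wq_def
    have fe: "u * wq = v * wz" and nzs: "v \<noteq> 0" "wz \<noteq> 0" "wq \<noteq> 0"
      using functional_equation[OF side(1)] z by (auto simp: defs)
    have det: "c * (g * S - f * T) = 1"
      using C_determinant[OF side(2) n] nz by (simp add: c_def s_def defs)
    have Mz: "poly M11 z = u * f * S' - v * f' * S" "poly M12 z = u * g * S' - v * f' * T"
      "poly M21 z = u * f * T' - v * g' * S" "poly M22 z = u * g * T' - v * g' * T"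
      using M11(2)[OF side(4)] M12(2)[OF side(4)] M21(2)[OF side(4)] M22(2)[OF side(4)]
      by (simp_all add: defs)
    have A: "A_mat \<mu> n \<Theta> \<Omega> \<Theta>s \<Omega>s z =
        vector [vector [c * poly M12 z, - c * poly M11 z], vector [c * poly M22 z, - c * poly M21 z]]"
      using nz unfolding A_mat_def Suc_eq_plus1[symmetric] a_def[symmetric]
      by (simp add: \<Theta>_def \<Omega>_def \<Theta>s_def \<Omega>s_def c_def N)
    have Y: "Y_mat \<mu> w n z =
        vector [vector [f, - 2 * \<i> * z ^ n * S / wz], vector [g, - 2 * \<i> * z ^ n * T / wz]]"
      unfolding Y_mat_def eps_eq_C[OF side(2) n] eps_star_eq_C[OF side(2) n]
      by (simp add: defs)
    have Yq: "Y_mat \<mu> w n (q * z) =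
        vector [vector [f', - 2 * \<i> * z ^ n * S' / wq], vector [g', - 2 * \<i> * z ^ n * T' / wq]]"
      unfolding Y_mat_def eps_eq_C[OF side(3) n] eps_star_eq_C[OF side(3) n]
      by (simp add: defs power_mult_distrib mult_ac)
    \<comment> \<open>This exchanges the denominator \<open>w z\<close> of the second column for
      \<open>w (q * z)\<close>.\<close>
    have uw: "u / wz = v / wq" using fe nzs by (simp add: field_simps)
    \<comment> \<open>Cramer's rule with the determinant normalized by \<open>det\<close>. Both rows
      follow from it, with \<open>P\<close>, \<open>p\<close> equal to \<open>S'\<close>,
      \<open>f'\<close> and to \<open>T'\<close>, \<open>g'\<close>.\<close>
    have row: "c * (u * g * P - v * p * T) * f - c * (u * f * P - v * p * S) * g = v * p"
      "c * (u * g * P - v * p * T) * S - c * (u * f * P - v * p * S) * T = u * P" for P p :: complex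
      using det by algebra+
    have col: "(c * (u * g * P - v * p * T) * (- 2 * \<i> * z ^ n * S / wz) -
        c * (u * f * P - v * p * S) * (- 2 * \<i> * z ^ n * T / wz)) / v = - 2 * \<i> * z ^ n * P / wq" for P p :: complex
    proof -
      have "(c * (u * g * P - v * p * T) * (- 2 * \<i> * z ^ n * S / wz) -
        c * (u * f * P - v * p * S) * (- 2 * \<i> * z ^ n * T / wz)) / v =
        - 2 * \<i> * z ^ n * (c * (u * g * P - v * p * T) * S - c * (u * f * P - v * p * S) * T) / (wz * v)"
        using nzs by (simp add: field_simps)
      also have "\<dots> = - 2 * \<i> * z ^ n * P * (u / wz) / v"
        unfolding row(2) using nzs by simp
      also have "\<dots> = - 2 * \<i> * z ^ n * P / wq"
        unfolding uw using nzs by simp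
      finally show ?thesis .
    qed
    show "Y_mat \<mu> w n (of_real q * z) =
        mat (1 / poly V z) ** A_mat \<mu> n \<Theta> \<Omega> \<Theta>s \<Omega>s z ** Y_mat \<mu> w n z"
      unfolding A Y Yq Mz v_def[symmetric]
      using row(1)[of S' f'] row(1)[of T' g'] col[of S' f'] col[of T' g'] nzs
      by (intro matrix_2_eqI) (simp_all add: matrix_2_simps, simp_all add: field_simps)
  qed
  ultimately show ?thesis using th d\<Theta> d\<Theta>s d\<Omega> d\<Omega>s by blast
qed

lemma compatibility:
  fixes z :: complex
  assumes n: "1 \<le> n"
    and sys: "q_difference_system q V \<mu> w n (A_mat \<mu> n \<Theta> \<Omega> \<Theta>s \<Omega>s)"
    and sys': "q_difference_system q V \<mu> w (n + 1) (A_mat \<mu> (n + 1) \<Theta>' \<Omega>' \<Theta>s' \<Omega>s')"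
  shows "A_mat \<mu> (n + 1) \<Theta>' \<Omega>' \<Theta>s' \<Omega>s' z ** B_mat \<mu> n z =
         B_mat \<mu> n (of_real q * z) ** A_mat \<mu> n \<Theta> \<Omega> \<Theta>s \<Omega>s z"
proof -
  let ?A = "A_mat \<mu> n \<Theta> \<Omega> \<Theta>s \<Omega>s" and ?A' = "A_mat \<mu> (n + 1) \<Theta>' \<Omega>' \<Theta>s' \<Omega>s'"
  let ?B = "B_mat \<mu> n" and ?Y = "Y_mat \<mu> w n"
  define G where "G = {z \<in> ball 0 1 - {0 :: complex}. poly V z \<noteq> 0 \<and> w z \<noteq> 0 \<and> w (of_real q * z) \<noteq> 0}"
  have "ball (0::complex) 1 - {0} \<noteq> {}"
  proof -
    have "1/2 \<in> ball (0::complex) 1 - {0}" by simp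
    then show ?thesis by blast
  qed
  then have G: "open G" "G \<noteq> {}"
    unfolding G_def using regular_points_dense[of "ball 0 1 - {0}"] by auto
  have eqG: "?A' z ** ?B z = ?B (of_real q * z) ** ?A z" if "z \<in> G" for z :: complex
  proof (rule matrix_mult_right_cancel)
    have z: "z \<in> same_side q" "poly V z \<noteq> 0" "w z \<noteq> 0" "w (q * z) \<noteq> 0" "z \<noteq> 0"
      using that by (auto simp: G_def same_side_def)
    note side = same_side_norm[OF z(1)]
    show "det (?Y z) \<noteq> 0"
      using z opuc_norm2_nonzero[of n] by (simp add: det_Y_mat[OF side(2) n])
    \<comment> \<open>Compute \<open>Y_mat\<close> of index \<open>n + 1\<close> at
      \<open>q * z\<close> in two ways: by the system of index \<open>n + 1\<close>, and by the
      recursion at \<open>q * z\<close> followed by the system of index \<open>n\<close>.\<close>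
    have "mat (1 / poly V z) ** (?A' z ** ?B z ** ?Y z) = mat (1 / poly V z) ** ?A' z ** Y_mat \<mu> w (n + 1) z"
      using Y_mat_Suc[OF side(2) n] by (simp add: matrix_mul_assoc)
    also have "\<dots> = Y_mat \<mu> w (n + 1) (q * z)"
      using sys' z by (simp add: q_difference_system_def)
    also have "\<dots> = ?B (q * z) ** ?Y (q * z)"
      using Y_mat_Suc[OF side(3) n] by simp
    also have "\<dots> = ?B (q * z) ** (mat (1 / poly V z) ** ?A z ** ?Y z)"
      using sys z by (simp add: q_difference_system_def)
    also have "\<dots> = mat (1 / poly V z) ** (?B (q * z) ** ?A z ** ?Y z)"
      unfolding matrix_mul_assoc mat_matrix_mult_commute[of _ "?B (q * z)"] ..
    finally have "mat (poly V z) ** (mat (1 / poly V z) ** (?A' z ** ?B z ** ?Y z)) =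
        mat (poly V z) ** (mat (1 / poly V z) ** (?B (q * z) ** ?A z ** ?Y z))"
      by simp
    then show "?A' z ** ?B z ** ?Y z = ?B (of_real q * z) ** ?A z ** ?Y z"
      using z by (simp add: matrix_mul_assoc mat_mult_mat)
  qed
  \<comment> \<open>The matrix entries are entire functions, so agreement on the open set
    \<open>G\<close> gives agreement everywhere.\<close>
  have ext: "f z = g z" if "f holomorphic_on UNIV" "g holomorphic_on UNIV" "\<And>z::complex. z \<in> G \<Longrightarrow> f z = g z"
    for f g :: "complex \<Rightarrow> complex" and z :: complex
    using that G by (intro analytic_continuation_open[of G UNIV f g z]) auto
  have hol: "(\<lambda>z. (?A' z ** ?B z) $ i $ j) holomorphic_on UNIV"
    "(\<lambda>z. (?B (of_real q * z) ** ?A z) $ i $ j) holomorphic_on UNIV" for i j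
    using exhaust_2[of i] exhaust_2[of j]
    by (auto simp: A_mat_def B_mat_def matrix_2_simps intro!: holomorphic_intros)
  show ?thesis
    unfolding vec_eq_iff using ext[OF hol] eqG by simp
qed

end

theorem proposition3p1:
  fixes q :: real and w :: "complex \<Rightarrow> complex" and \<mu> :: "complex measure"
    and V W :: "complex poly" and n D :: nat
  assumes "0 < q" and "q < 1"
    and "w holomorphic_on (UNIV - {0})"
    and "w ` sphere 0 1 \<subseteq> \<real>\<^sub>\<ge>\<^sub>0"
    and "\<exists>z. z \<noteq> 0 \<and> w z \<noteq> 0"
    and "\<mu> = circle_measure w"
    and "W \<noteq> 0"
    and "\<forall>z. z \<noteq> 0 \<longrightarrow> poly W z \<noteq> 0 \<longrightarrow> w (of_real q * z) = poly V z / poly W z * w z"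
    and "D = max (degree V) (degree W)"
    and "n \<ge> 1"
    and "verblunsky \<mu> (n+1) \<noteq> 0"
  shows "(\<exists>\<Theta> \<Omega>. is_Theta q V W \<mu> n \<Theta> \<and> (\<Theta> = 0 \<or> degree \<Theta> < D) \<and>
                 is_Omega q V W \<mu> n \<Omega> \<and> degree \<Omega> \<le> D \<and>
                 (\<exists>\<Theta>s \<Omega>s. (\<Theta>s = 0 \<or> degree \<Theta>s < D) \<and> degree \<Omega>s \<le> D \<and>
                    q_difference_system q V \<mu> w n (A_mat \<mu> n \<Theta> \<Omega> \<Theta>s \<Omega>s))) \<and>
         (verblunsky \<mu> (n+2) \<noteq> 0 \<longrightarrow>
            (\<forall>z. z \<noteq> 0 \<longrightarrow> cmod z \<noteq> 1 \<longrightarrow> w z \<noteq> 0 \<longrightarrow>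
               Y_mat \<mu> w (n+1) z = B_mat \<mu> n z ** Y_mat \<mu> w n z) \<and>
            (\<forall>\<Theta> \<Omega> \<Theta>s \<Omega>s \<Theta>' \<Omega>' \<Theta>s' \<Omega>s'.
               is_Theta q V W \<mu> n \<Theta> \<longrightarrow> is_Omega q V W \<mu> n \<Omega> \<longrightarrow>
               q_difference_system q V \<mu> w n (A_mat \<mu> n \<Theta> \<Omega> \<Theta>s \<Omega>s) \<longrightarrow>
               is_Theta q V W \<mu> (n+1) \<Theta>' \<longrightarrow> is_Omega q V W \<mu> (n+1) \<Omega>' \<longrightarrow>
               q_difference_system q V \<mu> w (n+1) (A_mat \<mu> (n+1) \<Theta>' \<Omega>' \<Theta>s' \<Omega>s') \<longrightarrow>
               (\<forall>z. A_mat \<mu> (n+1) \<Theta>' \<Omega>' \<Theta>s' \<Omega>s' z ** B_mat \<mu> n z =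
                    B_mat \<mu> n (of_real q * z) ** A_mat \<mu> n \<Theta> \<Omega> \<Theta>s \<Omega>s z)))"
proof -
  interpret q_circle_weight w q V W
    using assms by unfold_locales auto
  show ?thesis
    unfolding assms(6)
    using q_difference_system_exists[of D n] compatibility[of n] Y_mat_Suc[of _ n] assms(6,9-11)
    by auto
qed

end
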